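(* Let $m$ be a positive integer and let $\lambda/\mu$ be a skew shape such that every row of $\lambda/\mu$ contains a multiple of $m$ boxes. Then there is an action of the cyclic group of order $m$ on $\mathrm{SYT}(\lambda/\mu)$, with generator acting as $\rho$, such that $$\left(\mathrm{SYT}(\lambda/\mu),\ \langle\rho\rangle,\ f^{\lambda/\mu}(q)\right)$$ exhibits the cyclic sieving phenomenon.
   Context: English notation is used for diagrams. $\mathrm{SYT}(\lambda/\mu)$ is the set of standard Young tableaux of skew shape $\lambda/\mu$ with $n$ boxes (entries $1,\dots,n$, each once, increasing along rows and down columns). A descent of $T\in\mathrm{SYT}(\lambda/\mu)$ is $j\in\{1,\dots,n-1\}$ such that $j+1$ appears in a row of strictly larger index (strictly lower) than $j$; $\mathrm{maj}(T)$ is the sum of the descents of $T$. The fake-degree polynomial is $f^{\lambda/\mu}(q)=\sum_{T\in \mathrm{SYT}(\lambda/\mu)}q^{\mathrm{maj}(T)}$. Cyclic sieving: let $X$ be a finite set, $\rho$ a generator of an action of the cyclic group of order $m$ on $X$ (so $\rho^m$ acts as the identity; the action need not be faithful), and $f(q)\in\mathbb{N}[q]$. The triple $(X,\langle\rho\rangle,f(q))$ exhibits the cyclic sieving phenomenon if for all $d\in\mathbb{Z}$, $\#\{x\in X:\rho^d\cdot x=x\}=f(\zeta^d)$, where $\zeta$ is a primitive $m$-th root of unity. *)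

theory Defs
  imports
    Complex_Main
    "HOL-Algebra.Elementary_Groups"
    "HOL-Algebra.Group_Action"
    "HOL-Computational_Algebra.Polynomial"
begin

text \<open>
  A partition is its sequence of parts, continued by zeros. Rows and columns are numbered from 0;
  in English notation, row 0 is the top row, so a larger row index means strictly lower.
\<close>

definition int_partition :: "(nat \<Rightarrow> nat) \<Rightarrow> bool" where
  "int_partition p \<longleftrightarrow> antimono p \<and> finite {i. p i \<noteq> 0}"

definition skew_shape :: "(nat \<Rightarrow> nat) \<Rightarrow> (nat \<Rightarrow> nat) \<Rightarrow> bool" where
  "skew_shape la mu \<longleftrightarrow> int_partition la \<and> int_partition mu \<and> (\<forall>i. mu i \<le> la i)"

definition skew_diagram :: "(nat \<Rightarrow> nat) \<Rightarrow> (nat \<Rightarrow> nat) \<Rightarrow> (nat \<times> nat) set" where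
  "skew_diagram la mu = {(i, j). mu i \<le> j \<and> j < la i}"

definition row_boxes :: "(nat \<Rightarrow> nat) \<Rightarrow> (nat \<Rightarrow> nat) \<Rightarrow> nat \<Rightarrow> (nat \<times> nat) set" where
  "row_boxes la mu i = {b \<in> skew_diagram la mu. fst b = i}"

text \<open>Tableaux are extensional, so that each filling of the diagram is counted once.\<close>

definition SYT :: "(nat \<Rightarrow> nat) \<Rightarrow> (nat \<Rightarrow> nat) \<Rightarrow> (nat \<times> nat \<Rightarrow> nat) set" where
  "SYT la mu = {T \<in> extensional (skew_diagram la mu).
     bij_betw T (skew_diagram la mu) {1..card (skew_diagram la mu)} \<and>
     (\<forall>i j j'. (i, j) \<in> skew_diagram la mu \<longrightarrow> (i, j') \<in> skew_diagram la mu \<longrightarrow>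
        j < j' \<longrightarrow> T (i, j) < T (i, j')) \<and>
     (\<forall>i i' j. (i, j) \<in> skew_diagram la mu \<longrightarrow> (i', j) \<in> skew_diagram la mu \<longrightarrow>
        i < i' \<longrightarrow> T (i, j) < T (i', j))}"

definition descents ::
    "(nat \<Rightarrow> nat) \<Rightarrow> (nat \<Rightarrow> nat) \<Rightarrow> (nat \<times> nat \<Rightarrow> nat) \<Rightarrow> nat set" where
  "descents la mu T = {k \<in> {1..<card (skew_diagram la mu)}.
     \<exists>b\<in>skew_diagram la mu. \<exists>b'\<in>skew_diagram la mu.
       T b = k \<and> T b' = k + 1 \<and> fst b < fst b'}"

definition maj :: "(nat \<Rightarrow> nat) \<Rightarrow> (nat \<Rightarrow> nat) \<Rightarrow> (nat \<times> nat \<Rightarrow> nat) \<Rightarrow> nat" where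
  "maj la mu T = \<Sum>(descents la mu T)"

definition fake_degree :: "(nat \<Rightarrow> nat) \<Rightarrow> (nat \<Rightarrow> nat) \<Rightarrow> nat poly" where
  "fake_degree la mu = (\<Sum>T\<in>SYT la mu. monom 1 (maj la mu T))"

definition primitive_root_of_unity :: "nat \<Rightarrow> complex \<Rightarrow> bool" where
  "primitive_root_of_unity m z \<longleftrightarrow>
     0 < m \<and> z ^ m = 1 \<and> (\<forall>k. 0 < k \<and> k < m \<longrightarrow> z ^ k \<noteq> 1)"

text \<open>
  The permutation \<open>\<rho>\<close> of \<open>X\<close> is the action of a generator of the cyclic group of order \<open>m\<close>. The
  action need not be faithful, so the order of \<open>\<rho>\<close> is only required to divide \<open>m\<close>. The power of
  \<open>\<rho>\<close> with an integer exponent is taken in the symmetric group of \<open>X\<close>.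
\<close>

definition cyclic_sieving :: "'a set \<Rightarrow> nat \<Rightarrow> ('a \<Rightarrow> 'a) \<Rightarrow> nat poly \<Rightarrow> bool" where
  "cyclic_sieving X m \<rho> f \<longleftrightarrow>
     finite X \<and> 0 < m \<and>
     \<rho> \<in> carrier (BijGroup X) \<and> \<rho> [^]\<^bsub>BijGroup X\<^esub> m = \<one>\<^bsub>BijGroup X\<^esub> \<and>
     (\<forall>\<zeta>. primitive_root_of_unity m \<zeta> \<longrightarrow>
       (\<forall>d::int. of_nat (card {x \<in> X. (\<rho> [^]\<^bsub>BijGroup X\<^esub> d) x = x}) =
                 poly (map_poly of_nat f) (\<zeta> powi d)))"

end

theory Submission
  imports Defs "HOL-Combinatorics.Permutations"
begin

text \<open>
  Let \<open>F k\<close> be the value of the fake degree at a primitive root of unity of order \<open>k\<close>. An action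
  with \<open>N e\<close> orbits of size \<open>e\<close> exhibits the phenomenon exactly if
  \<open>F (m / d) = (\<Sum>e | e dvd d. e * N e)\<close> for all divisors \<open>d\<close> of \<open>m\<close>. These equations determine
  \<open>N\<close> by Moebius inversion, and the point is that the solutions are natural numbers. They are,
  because they count something: \<open>N e\<close> is the number of tableaux of major index 1 modulo \<open>e\<close> on the
  \<open>m / e\<close>-quotient of the shape.

  To see this, read a tableau as a walk of particles: the particle of row \<open>i\<close> starts at
  \<open>mu i - i\<close>, ends at \<open>la i - i\<close>, and entry \<open>k\<close> moves the particle of its row by one step. A word
  of rows is a tableau if and only if no two particles ever meet (\<open>bij_betw_tableau_word\<close>). The
  \<open>k\<close>-quotient keeps the rows, divides all positions by \<open>k\<close>, and lets two particles collide only
  if their positions agree modulo \<open>k\<close>; as every row has a multiple of \<open>k\<close> boxes, each particle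
  stays in its residue class. In this form a quotient needs no rearrangement of rows, and one
  determinantal formula covers the shape and all its quotients (\<open>walk_gf_append\<close>): the generating
  function of the walks by major index is the sum, over the permutations \<open>p\<close> of the rows that
  preserve the classes, of the sign of \<open>p\<close> times the q-multinomial coefficient of the differences
  \<open>y l - x (p l)\<close>. At a root of unity of order \<open>j\<close> a q-multinomial coefficient vanishes unless all
  its entries are multiples of \<open>j\<close>, and then it is the multinomial coefficient of the quotients by
  \<open>j\<close>. Hence the \<open>k\<close>-quotient evaluated at order \<open>j\<close> gives \<open>F (k * j)\<close>
  (\<open>quotient_walks_at_root\<close>).

  By discrete Fourier inversion, \<open>e * N e\<close> is then a sum of the values \<open>F (m / gcd t e)\<close>, \<open>t < e\<close>,
  weighted by roots of unity, and summing over \<open>e dvd d\<close> everything but \<open>F (m / d)\<close> cancels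
  (\<open>sum_divisors_fourier\<close>). It remains to put on the set of tableaux a permutation with \<open>N e\<close>
  cycles of length \<open>e\<close> for each divisor \<open>e\<close> of \<open>m\<close>.
\<close>

section \<open>q-multinomial coefficients\<close>

definition qint :: "nat \<Rightarrow> complex poly" where
  "qint k = (\<Sum>j<k. monom 1 j)"

definition qfact :: "nat \<Rightarrow> complex poly" where
  "qfact n = (\<Prod>i=1..n. qint i)"

definition qmultinomial :: "nat \<Rightarrow> (nat \<Rightarrow> nat) \<Rightarrow> complex poly" where
  "qmultinomial r g = qfact (\<Sum>l<r. g l) div (\<Prod>l<r. qfact (g l))"

lemma qint_0 [simp]: "qint 0 = 0"
  by (simp add: qint_def)

lemma qint_Suc: "qint (Suc k) = qint k + monom 1 k"
  by (simp add: qint_def)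

lemma qint_add: "qint (a + b) = qint a + monom 1 a * qint b"
  by (induction b) (simp_all add: qint_Suc algebra_simps mult_monom)

lemma poly_qint: "poly (qint k) z = (\<Sum>j<k. z ^ j)"
  by (simp add: qint_def poly_sum poly_monom)

lemma qint_nonzero:
  assumes "0 < k"
  shows "qint k \<noteq> 0"
proof -
  have "poly (qint k) 1 \<noteq> 0"
    using assms by (simp add: poly_qint)
  then show ?thesis by auto
qed

lemma qfact_0 [simp]: "qfact 0 = 1"
  by (simp add: qfact_def)

lemma qfact_Suc: "qfact (Suc n) = qint (Suc n) * qfact n"
  by (simp add: qfact_def mult.commute)

lemma qfact_rec: "0 < n \<Longrightarrow> qfact n = qint n * qfact (n - 1)"
  using qfact_Suc[of "n - 1"] by simp

lemma qfact_nonzero: "qfact n \<noteq> 0"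
  by (simp add: qfact_def qint_nonzero)

text \<open>
  Splitting an interval of \<open>\<Sum>l<b. g l\<close> consecutive exponents into blocks of lengths \<open>g l\<close>. Both
  the integrality of q-multinomial coefficients and their recursion below come from it.
\<close>

lemma sum_monom_qint:
  fixes b :: nat
  shows "(\<Sum>l<b. monom 1 (\<Sum>j<l. g j) * qint (g l)) = qint (\<Sum>l<b. g l)"
  by (induction b) (simp_all add: qint_add)

lemma sum_lower:
  fixes g :: "nat \<Rightarrow> nat"
  assumes "l < r" "0 < g l"
  shows "(\<Sum>j<r. (g(l := g l - 1)) j) = (\<Sum>j<r. g j) - 1"
proof -
  have "(\<Sum>j<r. g j) = g l + (\<Sum>j\<in>{..<r}-{l}. g j)"
    using assms by (intro sum.remove) auto
  moreover have "(\<Sum>j<r. (g(l := g l - 1)) j)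
      = (g(l := g l - 1)) l + (\<Sum>j\<in>{..<r}-{l}. (g(l := g l - 1)) j)"
    using assms by (intro sum.remove) auto
  then have "(\<Sum>j<r. (g(l := g l - 1)) j) = (g l - 1) + (\<Sum>j\<in>{..<r}-{l}. g j)"
    by simp
  ultimately show ?thesis using assms by simp
qed

lemma prod_qfact_lower:
  fixes g :: "nat \<Rightarrow> nat"
  assumes "l < r" "0 < g l"
  shows "(\<Prod>j<r. qfact (g j)) = qint (g l) * (\<Prod>j<r. qfact ((g(l := g l - 1)) j))"
proof -
  have "(\<Prod>j<r. qfact (g j)) = qfact (g l) * (\<Prod>j\<in>{..<r}-{l}. qfact (g j))"
    by (rule prod.remove) (use assms in auto)
  moreover have "(\<Prod>j<r. qfact ((g(l := g l - 1)) j))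
      = qfact ((g(l := g l - 1)) l) * (\<Prod>j\<in>{..<r}-{l}. qfact ((g(l := g l - 1)) j))"
    by (rule prod.remove) (use assms in auto)
  then have "(\<Prod>j<r. qfact ((g(l := g l - 1)) j))
      = qfact (g l - 1) * (\<Prod>j\<in>{..<r}-{l}. qfact (g j))"
    by simp
  ultimately show ?thesis by (simp only: qfact_rec[OF assms(2)] mult.assoc)
qed

lemma prod_qfact_dvd:
  fixes g :: "nat \<Rightarrow> nat"
  shows "(\<Prod>l<r. qfact (g l)) dvd qfact (\<Sum>l<r. g l)"
proof (induction "\<Sum>l<r. g l" arbitrary: g)
  case 0
  then have "g l = 0" if "l < r" for l
    using that by (metis finite_lessThan lessThan_iff sum_eq_0_iff)
  then show ?case by simp
next
  case (Suc n)
  have "qfact (\<Sum>l<r. g l)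
      = (\<Sum>l<r. monom 1 (\<Sum>j<l. g j) * qint (g l)) * qfact n"
    unfolding sum_monom_qint Suc(2)[symmetric] by (rule qfact_Suc)
  also have "\<dots> = (\<Sum>l<r. monom 1 (\<Sum>j<l. g j) * (qint (g l) * qfact n))"
    by (simp add: sum_distrib_right mult.assoc)
  finally have eq: "qfact (\<Sum>l<r. g l)
      = (\<Sum>l<r. monom 1 (\<Sum>j<l. g j) * (qint (g l) * qfact n))" .
  have "(\<Prod>l<r. qfact (g l)) dvd qint (g l) * qfact n" if l: "l < r" for l
  proof (cases "g l = 0")
    case False
    then have pos: "0 < g l" by simp
    have n: "n = (\<Sum>j<r. (g(l := g l - 1)) j)"
      using sum_lower[where g = g, OF l pos] Suc(2) by linarith
    have "(\<Prod>j<r. qfact ((g(l := g l - 1)) j)) dvd qfact n"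
      using Suc(1)[OF n] n by simp
    then show ?thesis
      unfolding prod_qfact_lower[where g = g, OF l pos] by (rule mult_dvd_mono[OF dvd_refl])
  qed simp
  then show ?case unfolding eq by (intro dvd_sum dvd_mult[where b = "_ * qfact n"]) auto
qed

lemma qmultinomial_times_qfacts:
  "qmultinomial r g * (\<Prod>l<r. qfact (g l)) = qfact (\<Sum>l<r. g l)"
  unfolding qmultinomial_def using prod_qfact_dvd by (rule dvd_div_mult_self)

text \<open>
  The q-multinomial coefficient is the generating function by major index of the words of content
  \<open>g\<close>, and the factor in front of it accounts for appending one more letter \<open>i\<close>. On the right, the
  words are sorted by their last letter \<open>l\<close>: appending \<open>i\<close> creates an ascent at position \<open>N\<close> exactly
  if \<open>l < i\<close>. The identity holds because the exponents below \<open>i\<close>, shifted by \<open>N\<close>, continue the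
  block of exponents from \<open>i\<close> on.
\<close>

lemma qmultinomial_append:
  assumes "i \<le> r" and N: "N = (\<Sum>l<r. g l)" "0 < N"
  shows "monom 1 (\<Sum>l<i. g l) * qmultinomial r g =
    (\<Sum>l<r. if 0 < g l
      then monom 1 ((if l < i then N else 0) + (\<Sum>j<l. g j)) * qmultinomial r (g(l := g l - 1))
      else 0)" (is "_ = (\<Sum>l<r. ?t l)")
proof -
  let ?P = "\<Prod>l<r. qfact (g l)"
  let ?m = "\<lambda>l. monom 1 (\<Sum>j<l. g j) * qint (g l)"
  have summand: "?t l * ?P = (if l < i then monom 1 N else 1) * ?m l * qfact (N - 1)"
    if l: "l < r" for l
  proof (cases "0 < g l")
    case True
    have "?t l * ?P = monom 1 ((if l < i then N else 0) + (\<Sum>j<l. g j)) * qint (g l) *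
        (qmultinomial r (g(l := g l - 1)) * (\<Prod>j<r. qfact ((g(l := g l - 1)) j)))"
      unfolding prod_qfact_lower[where g = g, OF l True] using True by (simp only: if_True ac_simps)
    also have "\<dots> = monom 1 ((if l < i then N else 0) + (\<Sum>j<l. g j)) * qint (g l) * qfact (N - 1)"
      unfolding qmultinomial_times_qfacts sum_lower[where g = g, OF l True] N(1) ..
    also have "\<dots> = (if l < i then monom 1 N else 1) * ?m l * qfact (N - 1)"
      by (simp add: mult_monom flip: mult.assoc)
    finally show ?thesis .
  qed simp
  define a where "a = (\<Sum>l<i. g l)"
  define b where "b = (\<Sum>l\<in>{i..<r}. g l)"
  have split: "(\<Sum>l<r. f l) = (\<Sum>l<i. f l) + (\<Sum>l\<in>{i..<r}. f l)"
    for f :: "nat \<Rightarrow> 'b::comm_monoid_add"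
    using sum.atLeastLessThan_concat[of 0 i r f] \<open>i \<le> r\<close> by (simp add: atLeast0LessThan)
  have Nab: "N = a + b" unfolding N a_def b_def by (rule split)
  have low: "(\<Sum>l<i. ?m l) = qint a" unfolding a_def by (rule sum_monom_qint)
  have "(\<Sum>l<r. ?m l) = qint N" unfolding N by (rule sum_monom_qint)
  then have high: "(\<Sum>l\<in>{i..<r}. ?m l) = monom 1 a * qint b"
    using split[of ?m] low by (simp add: Nab qint_add)
  have "(\<Sum>l<r. ?t l) * ?P =
      (\<Sum>l<r. (if l < i then monom 1 N else 1) * ?m l * qfact (N - 1))"
    unfolding sum_distrib_right by (rule sum.cong[OF refl]) (use summand in simp)
  also have "\<dots> = (monom 1 N * (\<Sum>l<i. ?m l) + (\<Sum>l\<in>{i..<r}. ?m l)) * qfact (N - 1)"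
    unfolding split by (simp add: sum_distrib_right sum_distrib_left distrib_right mult.assoc)
  also have "\<dots> = monom 1 a * (qint (b + a)) * qfact (N - 1)"
    unfolding low high qint_add Nab by (simp add: algebra_simps mult_monom)
  also have "\<dots> = monom 1 a * qfact N"
    using qfact_rec[OF N(2)] Nab by (simp add: ac_simps)
  also have "\<dots> = (monom 1 a * qmultinomial r g) * ?P"
    unfolding N(1) by (simp only: qmultinomial_times_qfacts mult.assoc)
  finally have "(\<Sum>l<r. ?t l) * ?P = (monom 1 a * qmultinomial r g) * ?P" .
  moreover have "?P \<noteq> 0" by (simp add: qfact_nonzero)
  ultimately have "(\<Sum>l<r. ?t l) = monom 1 a * qmultinomial r g"
    using mult_cancel_right by blast
  then show ?thesis unfolding a_def by simp
qed

lemma qmultinomial_permute: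
  assumes "p permutes {..<r}"
  shows "qmultinomial r (\<lambda>l. g (p l)) = qmultinomial r g"
  unfolding qmultinomial_def
  using sum.permute[OF assms, of g] prod.permute[OF assms, of "\<lambda>l. qfact (g l)"]
  by (simp add: comp_def)

section \<open>Roots of unity\<close>

lemma primitive_root_power_eq_1_iff:
  assumes "primitive_root_of_unity k z"
  shows "z ^ i = 1 \<longleftrightarrow> k dvd i"
proof -
  have k: "0 < k" "z ^ k = 1" "\<And>j. 0 < j \<Longrightarrow> j < k \<Longrightarrow> z ^ j \<noteq> 1"
    using assms by (auto simp: primitive_root_of_unity_def)
  have "z ^ i = z ^ (k * (i div k) + i mod k)" by simp
  also have "\<dots> = z ^ (i mod k)"
    unfolding power_add power_mult k(2) by simp
  finally have "z ^ i = 1 \<longleftrightarrow> z ^ (i mod k) = 1" by simp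
  also have "\<dots> \<longleftrightarrow> i mod k = 0"
    using k(3)[of "i mod k"] k(1) by (cases "i mod k = 0") auto
  finally show ?thesis by (simp add: dvd_eq_mod_eq_0)
qed

lemma primitive_root_of_unity_iff:
  "primitive_root_of_unity k z \<longleftrightarrow> 0 < k \<and> (\<forall>i. z ^ i = 1 \<longleftrightarrow> k dvd i)"
proof
  assume "primitive_root_of_unity k z"
  then show "0 < k \<and> (\<forall>i. z ^ i = 1 \<longleftrightarrow> k dvd i)"
    using primitive_root_power_eq_1_iff[of k z] unfolding primitive_root_of_unity_def by blast
qed (auto simp: primitive_root_of_unity_def dest: dvd_imp_le)

lemma primitive_root_power:
  assumes "primitive_root_of_unity e z"
  shows "primitive_root_of_unity (e div gcd t e) (z ^ t)"
proof -
  have e: "0 < e" and z: "\<And>i. z ^ i = 1 \<longleftrightarrow> e dvd i"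
    using assms by (auto simp: primitive_root_of_unity_iff)
  define g where "g = gcd t e"
  have g: "g \<noteq> 0" using e by (simp add: g_def)
  then obtain t' e' where te: "t = t' * g" "e = e' * g" "coprime t' e'"
    using gcd_coprime_exists[of t e] unfolding g_def by blast
  have "(z ^ t) ^ i = 1 \<longleftrightarrow> e' dvd i" for i
  proof -
    have "(z ^ t) ^ i = 1 \<longleftrightarrow> e dvd t * i" by (simp add: z flip: power_mult)
    also have "\<dots> \<longleftrightarrow> e' dvd t' * i" unfolding te using g by (simp add: ac_simps)
    also have "\<dots> \<longleftrightarrow> e' dvd i"
      using te(3) by (simp add: coprime_commute coprime_dvd_mult_right_iff)
    finally show ?thesis .
  qed
  moreover have "e div g = e'" "0 < e'" using te g e by auto
  ultimately show ?thesis unfolding primitive_root_of_unity_iff g_def[symmetric] by simp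
qed

lemma primitive_root_nonzero: "primitive_root_of_unity k z \<Longrightarrow> z \<noteq> 0"
  unfolding primitive_root_of_unity_def by (metis power_eq_0_iff zero_neq_one zero_power)

lemma primitive_root_inverse:
  "primitive_root_of_unity k z \<Longrightarrow> primitive_root_of_unity k (inverse z)"
  by (simp add: primitive_root_of_unity_def power_inverse)

lemma primitive_root_power_eq_iff:
  assumes z: "primitive_root_of_unity e z"
  shows "z ^ a = z ^ b \<longleftrightarrow> a mod e = b mod e"
proof (induction a b rule: linorder_wlog)
  case (le a b)
  have "z \<noteq> 0" using primitive_root_nonzero[OF z] .
  have "z ^ a = z ^ b \<longleftrightarrow> z ^ (b - a) = 1"
    using \<open>z \<noteq> 0\<close> le by (auto simp: power_diff)
  also have "\<dots> \<longleftrightarrow> e dvd b - a" using z by (simp add: primitive_root_of_unity_iff)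
  also have "\<dots> \<longleftrightarrow> b mod e = a mod e" using le by (simp add: mod_eq_dvd_iff_nat)
  finally show ?case by auto
qed (auto simp: eq_commute)

definition unit_root :: "nat \<Rightarrow> complex" where
  "unit_root e = cis (2 * pi / real e)"

lemma unit_root_power: "unit_root e ^ k = cis (2 * pi * real k / real e)"
  by (simp add: unit_root_def DeMoivre mult.commute)

lemma primitive_unit_root:
  assumes "0 < e"
  shows "primitive_root_of_unity e (unit_root e)"
  unfolding primitive_root_of_unity_def
proof (intro conjI allI impI)
  show "unit_root e ^ e = 1" using assms by (simp add: unit_root_power)
  fix k assume k: "0 < k \<and> k < e"
  have "inj_on (\<lambda>k. cis (2 * pi * real k / real e)) {..<e}"
    using bij_betw_roots_unity[OF assms] by (simp add: bij_betw_def)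
  then have "cis (2 * pi * real k / real e) \<noteq> cis (2 * pi * real 0 / real e)"
    using k by (subst inj_on_eq_iff) auto
  then show "unit_root e ^ k \<noteq> 1" by (simp add: unit_root_power)
qed (fact assms)

lemma sum_powers_root_of_unity:
  assumes "z ^ e = 1"
  shows "(\<Sum>t<e. z ^ t) = (if z = 1 then of_nat e else (0::complex))"
proof (cases "z = 1")
  case False
  have "z ^ e - 1 = (z - 1) * (\<Sum>t<e. z ^ t)" by (rule power_diff_1_eq)
  then show ?thesis using False assms by simp
qed simp

section \<open>q-multinomial coefficients at roots of unity\<close>

lemma poly_qint_at_root:
  assumes "primitive_root_of_unity k z" "\<not> k dvd i"
  shows "poly (qint i) z \<noteq> 0"
proof
  assume "poly (qint i) z = 0"
  then have "z ^ i - 1 = 0"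
    by (simp add: power_diff_1_eq poly_qint)
  then show False using primitive_root_power_eq_1_iff[OF assms(1)] assms(2) by simp
qed

lemma poly_qint_order_at_root:
  assumes "primitive_root_of_unity k z" "k \<noteq> 1"
  shows "poly (qint k) z = 0"
proof -
  have "z ^ k - 1 = 0" "z ^ 1 \<noteq> 1"
    unfolding right_minus_eq primitive_root_power_eq_1_iff[OF assms(1)] using assms(2) by auto
  then show ?thesis by (simp add: power_diff_1_eq poly_qint)
qed

lemma qint_mult: "qint (k * a) = qint k * (\<Sum>j<a. monom 1 (k * j))"
proof (induction a)
  case (Suc a)
  have "qint (k * Suc a) = qint (k * a + k)" by (simp add: add.commute)
  also have "\<dots> = qint (k * a) + monom 1 (k * a) * qint k" by (rule qint_add)
  finally show ?case unfolding Suc by (simp add: algebra_simps)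
qed simp

text \<open>
  The factors \<open>qint k\<close>, which vanish at \<open>z\<close> (if \<open>k \<noteq> 1\<close>), are split off: each \<open>i \<le> n\<close> divisible
  by \<open>k\<close> contributes one, with a cofactor of value \<open>i div k\<close> at \<open>z\<close>. For the other \<open>i\<close>, the value
  of \<open>qint i\<close> at \<open>z\<close> depends only on \<open>i mod k\<close> and is not zero.
\<close>

lemma qfact_at_root:
  assumes z: "primitive_root_of_unity k z"
  obtains R where "qfact n = qint k ^ (n div k) * R"
    and "poly R z = (\<Prod>i=1..<k. poly (qint i) z) ^ (n div k) * fact (n div k) *
                   (\<Prod>i=1..n mod k. poly (qint i) z)"
proof (induction n arbitrary: thesis)
  case 0
  show ?case by (rule 0[of 1]) simp_all
next
  case (Suc n)
  obtain R where R: "qfact n = qint k ^ (n div k) * R"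
    "poly R z = (\<Prod>i=1..<k. poly (qint i) z) ^ (n div k) * fact (n div k) *
                   (\<Prod>i=1..n mod k. poly (qint i) z)"
    by (rule Suc.IH)
  have k0: "0 < k" using z by (simp add: primitive_root_of_unity_def)
  have zk: "z ^ k = 1" using z by (simp add: primitive_root_of_unity_def)
  show ?case
  proof (cases "Suc n mod k = 0")
    case True
    define a where "a = n div k"
    have d: "Suc n div k = Suc a" using True by (simp add: div_Suc a_def)
    have md: "n mod k = k - 1"
      using True k0 by (metis Suc_eq_plus1 add_diff_cancel_right' mod_Suc old.nat.distinct(2))
    have "Suc n = k * Suc a" using d True by (metis mult_div_mod_eq add_0_right)
    then have q: "qint (Suc n) = qint k * (\<Sum>j<Suc a. monom 1 (k * j))"
      by (simp only: qint_mult)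
    show ?thesis
    proof (rule Suc.prems[of "(\<Sum>j<Suc a. monom 1 (k * j)) * R"])
      show "qfact (Suc n) = qint k ^ (Suc n div k) * ((\<Sum>j<Suc a. monom 1 (k * j)) * R)"
        unfolding qfact_Suc R(1) q d a_def[symmetric] by (simp add: algebra_simps)
      have "poly (\<Sum>j<Suc a. monom 1 (k * j)) z = of_nat (Suc a)"
        by (simp add: poly_sum poly_monom power_mult zk)
      moreover have "{1..<k} = {1..k - 1}" using k0 by auto
      ultimately show "poly ((\<Sum>j<Suc a. monom 1 (k * j)) * R) z =
        (\<Prod>i=1..<k. poly (qint i) z) ^ (Suc n div k) * fact (Suc n div k) *
                   (\<Prod>i=1..Suc n mod k. poly (qint i) z)"
        unfolding d poly_mult R(2) a_def[symmetric] md True by (simp add: algebra_simps)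
    qed
  next
    case False
    have d: "Suc n div k = n div k" "Suc n mod k = Suc (n mod k)"
      using False by (auto simp: div_Suc mod_Suc)
    have "k \<noteq> 1" using False by auto
    have "poly (qint (k * c + b)) z = poly (qint b) z" for b c
      using poly_qint_order_at_root[OF z \<open>k \<noteq> 1\<close>] zk
      by (simp add: qint_add qint_mult poly_monom power_mult)
    from this[of "n div k" "Suc (n mod k)"]
    have q: "poly (qint (Suc n)) z = poly (qint (Suc (n mod k))) z" by simp
    show ?thesis
    proof (rule Suc.prems[of "qint (Suc n) * R"])
      show "qfact (Suc n) = qint k ^ (Suc n div k) * (qint (Suc n) * R)"
        unfolding qfact_Suc R(1) d by (simp only: ac_simps)
      show "poly (qint (Suc n) * R) z = (\<Prod>i=1..<k. poly (qint i) z) ^ (Suc n div k) *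
        fact (Suc n div k) * (\<Prod>i=1..Suc n mod k. poly (qint i) z)"
        unfolding poly_mult R(2) q d by (simp add: ac_simps)
    qed
  qed
qed

text \<open>
  By the previous lemma, the order of vanishing at \<open>z\<close> is the total of the entries divided by \<open>k\<close>,
  minus the sum of the entries rounded down after division by \<open>k\<close>. It is zero only if no entry is
  rounded, and then the remaining factors cancel to an ordinary multinomial coefficient.
\<close>

lemma poly_qmultinomial_at_root:
  assumes z: "primitive_root_of_unity k z" and kN: "k dvd (\<Sum>l<r. g l)"
  shows "poly (qmultinomial r g) z =
    (if \<forall>l<r. k dvd g l then fact (\<Sum>l<r. g l div k) / (\<Prod>l<r. fact (g l div k)) else 0)"
proof -
  define N where "N = (\<Sum>l<r. g l)"
  define u where "u = (\<Prod>i=1..<k. poly (qint i) z)"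
  have k0: "0 < k" using z by (simp add: primitive_root_of_unity_def)
  have nz: "poly (qint i) z \<noteq> 0" if "0 < i" "i < k" for i
    by (rule poly_qint_at_root[OF z]) (use that in \<open>auto dest: dvd_imp_le\<close>)
  have u: "u \<noteq> 0" unfolding u_def using nz by auto
  have "\<exists>R. \<forall>n. qfact n = qint k ^ (n div k) * R n \<and>
      poly (R n) z = u ^ (n div k) * fact (n div k) * (\<Prod>i=1..n mod k. poly (qint i) z)"
    unfolding u_def by (rule choice) (blast intro: qfact_at_root[OF z])
  then obtain R where R: "\<And>n. qfact n = qint k ^ (n div k) * R n"
    "\<And>n. poly (R n) z = u ^ (n div k) * fact (n div k) * (\<Prod>i=1..n mod k. poly (qint i) z)"
    by blast
  have Rnz: "poly (R n) z \<noteq> 0" for n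
  proof -
    have "n mod k < k" using k0 by simp
    then show ?thesis unfolding R(2) using u nz by (auto simp: prod_zero_iff)
  qed
  define s where "s = (\<Sum>l<r. g l div k)"
  have le: "s \<le> N div k"
  proof -
    have "k * s \<le> N" unfolding s_def N_def sum_distrib_left by (rule sum_mono) simp
    then show ?thesis using k0 by (simp add: less_eq_div_iff_mult_less_eq mult.commute)
  qed
  have "qmultinomial r g * (qint k ^ s * (\<Prod>l<r. R (g l))) = qint k ^ (N div k) * R N"
    using qmultinomial_times_qfacts[of r g] unfolding R(1) prod.distrib N_def s_def
    by (simp add: power_sum)
  also have "\<dots> = qint k ^ s * (qint k ^ (N div k - s) * R N)"
    using le by (simp flip: power_add mult.assoc)
  finally have "qint k ^ s * (qmultinomial r g * (\<Prod>l<r. R (g l)))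
      = qint k ^ s * (qint k ^ (N div k - s) * R N)"
    by (simp only: ac_simps)
  then have eq: "qmultinomial r g * (\<Prod>l<r. R (g l)) = qint k ^ (N div k - s) * R N"
    using qint_nonzero[OF k0] by simp
  have eqz: "poly (qmultinomial r g) z * (\<Prod>l<r. poly (R (g l)) z) =
      poly (qint k) z ^ (N div k - s) * poly (R N) z"
    using arg_cong[OF eq, of "\<lambda>p. poly p z"] by (simp add: poly_prod)
  have Pnz: "(\<Prod>l<r. poly (R (g l)) z) \<noteq> 0" using Rnz by simp
  show ?thesis
  proof (cases "\<forall>l<r. k dvd g l")
    case True
    have "k * s = N" unfolding s_def N_def sum_distrib_left
      by (rule sum.cong) (use True in auto)
    then have sN: "s = N div k" using k0 by auto
    have "N mod k = 0" using \<open>k * s = N\<close> by auto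
    then have RN: "poly (R N) z = u ^ s * fact s" unfolding R(2) sN by simp
    have "(\<Prod>l<r. poly (R (g l)) z) = (\<Prod>l<r. u ^ (g l div k) * fact (g l div k))"
      by (rule prod.cong) (use True in \<open>auto simp: R(2)\<close>)
    also have "\<dots> = u ^ s * (\<Prod>l<r. fact (g l div k))"
      unfolding prod.distrib s_def power_sum ..
    finally have "poly (qmultinomial r g) z * (\<Prod>l<r. fact (g l div k)) = fact s"
      using eqz u sN RN by simp
    then show ?thesis using True by (simp add: s_def field_simps)
  next
    case False
    then obtain l where l: "l < r" "\<not> k dvd g l" by blast
    have "k * s < N" unfolding s_def N_def sum_distrib_left
    proof (rule sum_strict_mono_ex1)
      show "\<exists>a\<in>{..<r}. k * (g a div k) < g a"
      proof (intro bexI)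
        have "k * (g l div k) \<le> g l" by simp
        moreover have "k * (g l div k) \<noteq> g l" using l(2) by (metis dvd_triv_left)
        ultimately show "k * (g l div k) < g l" by linarith
      qed (use l in auto)
    qed auto
    moreover have "N = k * (N div k)" using kN by (simp add: N_def)
    ultimately have "s < N div k" using k0 by (metis mult_less_cancel1)
    moreover have "k \<noteq> 1" using l by auto
    ultimately have "poly (qint k) z ^ (N div k - s) = 0"
      using poly_qint_order_at_root[OF z] by simp
    then have "poly (qmultinomial r g) z * (\<Prod>l<r. poly (R (g l)) z) = 0"
      by (simp only: eqz mult_zero_left)
    then have "poly (qmultinomial r g) z = 0" using Pnz by (simp only: mult_eq_0_iff simp_thms)
    then show ?thesis using False by auto
  qed
qed

section \<open>Walks without collisions\<close>

text \<open>
  The generating function by major index of the words with \<open>c l\<close> letters \<open>l\<close> for each \<open>l < r\<close>,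
  after a further letter \<open>i\<close> has been appended; for \<open>i = 0\<close> this letter changes nothing.
\<close>

definition word_gf :: "nat \<Rightarrow> nat \<Rightarrow> (nat \<Rightarrow> int) \<Rightarrow> complex poly" where
  "word_gf r i c = (if \<forall>l<r. 0 \<le> c l
     then monom 1 (\<Sum>l<i. nat (c l)) * qmultinomial r (\<lambda>l. nat (c l)) else 0)"

text \<open>
  Words are lists with the latest letter first, so that appending a letter is \<open>#\<close>. The positions
  counted are the ascents: with letters standing for rows, these are the descents of a tableau.
\<close>

primrec word_maj :: "nat list \<Rightarrow> nat" where
  "word_maj [] = 0"
| "word_maj (i # w) = (if w \<noteq> [] \<and> hd w < i then length w else 0) + word_maj w"

text \<open>
  Only particles of the same class interact. In a class, the particle of a higher row is further
  ahead.
\<close>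

definition separated :: "nat \<Rightarrow> (nat \<Rightarrow> int) \<Rightarrow> (nat \<Rightarrow> int) \<Rightarrow> bool" where
  "separated r cls z \<longleftrightarrow> (\<forall>i j. i < j \<longrightarrow> j < r \<longrightarrow> cls i = cls j \<longrightarrow> z j < z i)"

text \<open>
  The recursion undoes the latest step, so it runs from the final configuration \<open>y\<close> back to \<open>x\<close>.
\<close>

primrec walk :: "nat \<Rightarrow> (nat \<Rightarrow> int) \<Rightarrow> (nat \<Rightarrow> int) \<Rightarrow> (nat \<Rightarrow> int) \<Rightarrow> nat list \<Rightarrow> bool" where
  "walk r cls x y [] \<longleftrightarrow> (\<forall>i<r. y i = x i)"
| "walk r cls x y (l # w) \<longleftrightarrow> l < r \<and> separated r cls y \<and> walk r cls x (y(l := y l - 1)) w"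

definition class_perms :: "nat \<Rightarrow> (nat \<Rightarrow> int) \<Rightarrow> (nat \<Rightarrow> nat) set" where
  "class_perms r cls = {p. p permutes {..<r} \<and> (\<forall>l<r. cls (p l) = cls l)}"

text \<open>
  For a single class and \<open>i = 0\<close>, this is the q-analogue of Aitken's determinant
  \<open>n! det (1 / (la i - mu j - i + j)!)\<close> for the number of tableaux, expanded over permutations.
\<close>

definition signed_gf ::
    "nat \<Rightarrow> (nat \<Rightarrow> int) \<Rightarrow> (nat \<Rightarrow> int) \<Rightarrow> nat \<Rightarrow> (nat \<Rightarrow> int) \<Rightarrow> complex poly" where
  "signed_gf r cls x i y =
     (\<Sum>p\<in>class_perms r cls. of_int (sign p) * word_gf r i (\<lambda>l. y l - x (p l)))"

lemma finite_class_perms: "finite (class_perms r cls)"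
  by (rule finite_subset[OF _ finite_permutations[of "{..<r}"]]) (auto simp: class_perms_def)

lemma sum_int_lower:
  fixes c :: "nat \<Rightarrow> int"
  assumes "l < r"
  shows "(\<Sum>j<r. (c(l := c l - 1)) j) = (\<Sum>j<r. c j) - 1"
proof -
  have "(\<Sum>j<r. c j) = c l + (\<Sum>j\<in>{..<r}-{l}. c j)"
    using assms by (intro sum.remove) auto
  moreover have "(\<Sum>j<r. (c(l := c l - 1)) j)
      = (c(l := c l - 1)) l + (\<Sum>j\<in>{..<r}-{l}. (c(l := c l - 1)) j)"
    using assms by (intro sum.remove) auto
  then have "(\<Sum>j<r. (c(l := c l - 1)) j) = (c l - 1) + (\<Sum>j\<in>{..<r}-{l}. c j)"
    by simp
  ultimately show ?thesis by simp
qed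

lemma word_gf_append:
  assumes "i \<le> r" and N: "(\<Sum>l<r. c l) = int N" "0 < N"
  shows "word_gf r i c =
    (\<Sum>l<r. monom 1 (if l < i then N else 0) * word_gf r l (c(l := c l - 1)))"
proof (cases "\<forall>l<r. 0 \<le> c l")
  case True
  define g where "g = (\<lambda>l. nat (c l))"
  have "int (\<Sum>l<r. g l) = (\<Sum>l<r. c l)"
    unfolding g_def of_nat_sum by (rule sum.cong) (use True in auto)
  then have Ng: "N = (\<Sum>l<r. g l)" using N by (simp del: of_nat_sum)
  have "word_gf r i c = monom 1 (\<Sum>l<i. g l) * qmultinomial r g"
    unfolding word_gf_def g_def using True by simp
  also note qmultinomial_append[OF \<open>i \<le> r\<close> Ng \<open>0 < N\<close>]
  also have "(\<Sum>l<r. if 0 < g l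
      then monom 1 ((if l < i then N else 0) + (\<Sum>j<l. g j)) * qmultinomial r (g(l := g l - 1))
      else 0) = (\<Sum>l<r. monom 1 (if l < i then N else 0) * word_gf r l (c(l := c l - 1)))"
  proof (rule sum.cong[OF refl])
    fix l assume "l \<in> {..<r}"
    then have l: "l < r" by simp
    show "(if 0 < g l
      then monom 1 ((if l < i then N else 0) + (\<Sum>j<l. g j)) * qmultinomial r (g(l := g l - 1))
      else 0) = monom 1 (if l < i then N else 0) * word_gf r l (c(l := c l - 1))"
    proof (cases "0 < g l")
      case pos: True
      have "(\<lambda>j. nat ((c(l := c l - 1)) j)) = g(l := g l - 1)"
        using pos by (auto simp: g_def fun_eq_iff)
      moreover have "\<forall>j<r. 0 \<le> (c(l := c l - 1)) j" using True pos by (auto simp: g_def)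
      moreover have "(\<Sum>j<l. nat ((c(l := c l - 1)) j)) = (\<Sum>j<l. g j)"
        by (rule sum.cong) (auto simp: g_def)
      ultimately show ?thesis using pos
        by (simp add: word_gf_def mult_monom flip: mult.assoc)
    next
      case False
      then have "\<not> 0 \<le> (c(l := c l - 1)) l" using True l by (auto simp: g_def)
      then have "word_gf r l (c(l := c l - 1)) = 0" unfolding word_gf_def using l by meson
      then show ?thesis using False by simp
    qed
  qed
  finally show ?thesis .
next
  case False
  then obtain a where a: "a < r" "c a < 0" by auto
  have "word_gf r l (c(l := c l - 1)) = 0" for l
  proof -
    have "\<not> 0 \<le> (c(l := c l - 1)) a" using a by auto
    then show ?thesis unfolding word_gf_def using a by meson
  qed
  then show ?thesis using False by (auto simp: word_gf_def)
qed

lemma word_gf_transpose: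
  assumes "a < r" "b < r" "i \<le> a" "i \<le> b"
  shows "word_gf r i (\<lambda>l. c (transpose a b l)) = word_gf r i c"
proof -
  have p: "transpose a b permutes {..<r}" using assms by (simp add: permutes_swap_id)
  have nonneg: "(\<forall>l<r. 0 \<le> c (transpose a b l)) \<longleftrightarrow> (\<forall>l<r. 0 \<le> c l)"
    using p assms by (metis transpose_involutory permutes_in_image lessThan_iff)
  have "(\<Sum>l<i. nat (c (transpose a b l))) = (\<Sum>l<i. nat (c l))"
    by (rule sum.cong) (use assms in \<open>auto simp: transpose_def\<close>)
  then show ?thesis
    unfolding word_gf_def nonneg using qmultinomial_permute[OF p, of "\<lambda>l. nat (c l)"] by auto
qed

text \<open>
  Exchanging the starting points of the two particles that meet reverses the sign and preserves the
  weight. Here \<open>i \<le> a\<close> is essential: the factor that accounts for appending \<open>i\<close> depends only on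
  letters below \<open>i\<close>, so the exchange does not affect it.
\<close>

lemma signed_gf_collision:
  assumes "a < b" "b < r" "i \<le> a" "cls a = cls b" and z: "z a = z b"
  shows "signed_gf r cls x i z = 0"
proof -
  let ?t = "transpose a b"
  let ?f = "\<lambda>p. of_int (sign p) * word_gf r i (\<lambda>l. z l - x (p l)) :: complex poly"
  have tp: "?t permutes {..<r}" using assms by (simp add: permutes_swap_id)
  have in_perms: "p \<circ> ?t \<in> class_perms r cls" if "p \<in> class_perms r cls" for p
  proof -
    have p: "p permutes {..<r}" "\<And>l. l < r \<Longrightarrow> cls (p l) = cls l"
      using that by (auto simp: class_perms_def)
    have "cls (p (?t l)) = cls l" if "l < r" for l
    proof -
      have "?t l < r" using that assms by (auto simp: transpose_def)
      then have "cls (p (?t l)) = cls (?t l)" using p by blast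
      also have "\<dots> = cls l" using assms by (auto simp: transpose_def)
      finally show ?thesis .
    qed
    then show ?thesis using permutes_compose[OF tp p(1)] by (simp add: class_perms_def)
  qed
  have flip: "?f (p \<circ> ?t) = - ?f p" if "p \<in> class_perms r cls" for p
  proof -
    have "p permutes {..<r}" using that by (simp add: class_perms_def)
    then have "permutation p" by (rule permutation_permutes[THEN iffD2, OF exI, OF conjI, rotated]) simp
    then have "sign (p \<circ> ?t) = - sign p"
      using assms by (simp add: sign_compose permutation_swap_id sign_swap_id)
    moreover have "(\<lambda>l. z l - x ((p \<circ> ?t) l)) = (\<lambda>l. (\<lambda>j. z j - x (p j)) (?t l))"
      using z by (auto simp: fun_eq_iff transpose_def)
    ultimately show ?thesis
      using word_gf_transpose[of a r b i "\<lambda>j. z j - x (p j)"] assms by simp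
  qed
  have "signed_gf r cls x i z = (\<Sum>p\<in>class_perms r cls. ?f (p \<circ> ?t))"
    unfolding signed_gf_def
    by (rule sum.reindex_bij_witness[where i = "\<lambda>p. p \<circ> ?t" and j = "\<lambda>p. p \<circ> ?t"])
      (use in_perms in \<open>auto simp: comp_assoc\<close>)
  also have "\<dots> = - signed_gf r cls x i z"
    unfolding signed_gf_def sum_negf[symmetric] by (rule sum.cong[OF refl]) (rule flip)
  finally have "2 * signed_gf r cls x i z = 0" by (simp add: eq_neg_iff_add_eq_0)
  then show ?thesis by simp
qed

text \<open>
  A permutation that carries one separated configuration to another is increasing on each class,
  hence the identity.
\<close>

lemma class_perm_separated_id:
  assumes p: "p \<in> class_perms r cls" and x: "separated r cls x" and y: "separated r cls y"
    and xy: "\<And>l. l < r \<Longrightarrow> y l = x (p l)"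
  shows "p = id"
proof -
  have pp: "p permutes {..<r}" and cls: "\<And>l. l < r \<Longrightarrow> cls (p l) = cls l"
    using p by (auto simp: class_perms_def)
  have lt: "p l < r" if "l < r" for l using permutes_in_image[OF pp, of l] that by simp
  have inj: "p a = p b \<Longrightarrow> a = b" for a b using permutes_inj[OF pp] by (simp add: inj_eq)
  have mono: "p a < p b" if "a < b" "b < r" "cls a = cls b" for a b
  proof (rule ccontr)
    assume "\<not> p a < p b"
    then have "p b < p a" using inj[of a b] that by fastforce
    then have "x (p a) < x (p b)" using x that lt cls by (auto simp: separated_def)
    moreover have "y b < y a" using y that by (auto simp: separated_def)
    ultimately show False using xy that by auto
  qed
  have "p l = l" if "l < r" for l
    using that
  proof (induction l rule: less_induct)
    case (less l)
    have "\<not> p l < l" using less inj lt by (metis less_irrefl order.strict_trans)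
    moreover have "\<not> l < p l"
    proof
      assume "l < p l"
      obtain b where b: "p b = l" using permutes_surj[OF pp] by (metis surjD)
      have "b < r" using b less.prems permutes_in_image[OF pp, of b] by simp
      have "\<not> b < l" using less.IH[of b] b \<open>b < r\<close> by auto
      moreover have "b \<noteq> l" using b \<open>l < p l\<close> by auto
      ultimately have "l < b" by simp
      then have "p l < p b" using mono \<open>b < r\<close> cls b by metis
      then show False using b \<open>l < p l\<close> by simp
    qed
    ultimately show ?case by simp
  qed
  then show ?thesis using permutes_not_in[OF pp] by (auto simp: fun_eq_iff)
qed

lemma walk_separated:
  assumes "separated r cls x" "walk r cls x y w"
  shows "separated r cls y"
  using assms by (cases w) (auto simp: separated_def)

lemma walk_letters: "walk r cls x y w \<Longrightarrow> set w \<subseteq> {..<r}"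
  by (induction w arbitrary: y) auto

lemma walk_length:
  "walk r cls x y w \<Longrightarrow> int (length w) = (\<Sum>l<r. y l - x l)"
proof (induction w arbitrary: y)
  case (Cons l w)
  then have l: "l < r" and "int (length w) = (\<Sum>j<r. (y(l := y l - 1)) j - x j)" by auto
  then show ?case using sum_int_lower[OF l, of y] by (simp add: sum_subtractf)
qed simp

lemma finite_walks: "finite {w. walk r cls x y w}"
proof (rule finite_subset)
  show "{w. walk r cls x y w} \<subseteq> {w. set w \<subseteq> {..<r} \<and> length w = nat (\<Sum>l<r. y l - x l)}"
    using walk_letters walk_length by fastforce
qed (simp add: finite_lists_length_eq)

text \<open>
  Refining by an appended letter makes the induction on the length work: both sides satisfy the same
  recursion in the last letter \<open>l\<close>. On the left only those \<open>l\<close> occur for which undoing the step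
  leaves a separated configuration. On the right all \<open>l\<close> occur, but the others contribute zero by
  \<open>signed_gf_collision\<close>, since undoing a step of \<open>l\<close> can only make \<open>l\<close> meet a particle of higher
  index.
\<close>

theorem walk_gf_append:
  assumes x: "separated r cls x" and "separated r cls y" "i \<le> r"
    and "(\<Sum>l<r. y l - x l) = int n"
  shows "(\<Sum>w | walk r cls x y w. monom 1 (word_maj (i # w))) = signed_gf r cls x i y"
  using assms(2-)
proof (induction n arbitrary: y i)
  case 0
  have walks: "walk r cls x y w \<longleftrightarrow> w = [] \<and> (\<forall>l<r. y l = x l)" for w
    using walk_length[of r cls x y w] 0 by (cases w) auto
  have gf: "word_gf r i (\<lambda>l. y l - x (p l)) = (if p = id \<and> (\<forall>l<r. y l = x l) then 1 else 0)"
    if p: "p \<in> class_perms r cls" for p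
  proof (cases "\<forall>l<r. 0 \<le> y l - x (p l)")
    case True
    have pp: "p permutes {..<r}" using p by (simp add: class_perms_def)
    have "(\<Sum>l<r. x (p l)) = (\<Sum>l<r. x l)"
      using sum.permute[OF pp, of x] by (simp add: comp_def)
    then have "(\<Sum>l<r. y l - x (p l)) = 0" using 0 by (simp add: sum_subtractf)
    then have "\<forall>l\<in>{..<r}. y l - x (p l) = 0"
      using True by (subst (asm) sum_nonneg_eq_0_iff) auto
    then have eq: "\<And>l. l < r \<Longrightarrow> y l = x (p l)" by auto
    then have "p = id" by (rule class_perm_separated_id[OF p x 0(1)])
    moreover have "word_gf r i (\<lambda>l. y l - x (p l)) = 1"
      using eq 0(2) by (simp add: word_gf_def qmultinomial_def)
    ultimately show ?thesis using eq by auto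
  next
    case False
    then show ?thesis by (auto simp: word_gf_def)
  qed
  have id: "id \<in> class_perms r cls" by (simp add: class_perms_def permutes_id)
  have "signed_gf r cls x i y =
      (\<Sum>p\<in>class_perms r cls. if p = id then (if \<forall>l<r. y l = x l then 1 else 0) else 0)"
    unfolding signed_gf_def by (rule sum.cong) (auto simp: gf sign_id)
  also have "\<dots> = (if \<forall>l<r. y l = x l then 1 else 0)"
    using id finite_class_perms by (simp add: sum.delta)
  finally show ?case by (auto simp: walks)
next
  case (Suc n)
  let ?y = "\<lambda>l. y(l := y l - 1)"
  let ?e = "\<lambda>l. monom (1::complex) (if l < i then Suc n else 0)"
  have sum_y: "(\<Sum>j<r. ?y l j - x j) = int n" if "l < r" for l
    using sum_int_lower[OF that, of y] Suc.prems by (simp add: sum_subtractf)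
  have IH: "(\<Sum>w | walk r cls x (?y l) w. monom 1 (word_maj (l # w))) = signed_gf r cls x l (?y l)"
    if l: "l < r" for l
  proof (cases "separated r cls (?y l)")
    case True
    show ?thesis by (rule Suc.IH[OF True _ sum_y]) (use l in auto)
  next
    case False
    then have "\<not> walk r cls x (?y l) w" for w using walk_separated[OF x] by blast
    then have "(\<Sum>w | walk r cls x (?y l) w. monom 1 (word_maj (l # w))) = (0 :: complex poly)"
      by simp
    moreover
    obtain a b where ab: "a < b" "b < r" "cls a = cls b" "\<not> ?y l b < ?y l a"
      using False unfolding separated_def by blast
    \<comment> \<open>Only particle \<open>l\<close> was moved, back by one step, so it is the one ahead, and now level.\<close>
    have "y b < y a" using Suc.prems(1) ab by (auto simp: separated_def)
    then have "a = l" "?y l a = ?y l b" using ab by (auto split: if_splits)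
    then have "signed_gf r cls x l (?y l) = 0"
      using ab signed_gf_collision[of a b r l cls "?y l" x] by simp
    ultimately show ?thesis by simp
  qed
  have "{w. walk r cls x y w} = (\<Union>l<r. (#) l ` {w. walk r cls x (?y l) w})"
  proof (intro equalityI subsetI)
    fix w assume "w \<in> {w. walk r cls x y w}"
    then have w: "walk r cls x y w" by simp
    then have "w \<noteq> []" using walk_length[OF w] Suc.prems by auto
    then show "w \<in> (\<Union>l<r. (#) l ` {w. walk r cls x (?y l) w})"
      using w by (cases w) auto
  qed (use Suc.prems in auto)
  then have "(\<Sum>w | walk r cls x y w. monom 1 (word_maj (i # w))) =
      (\<Sum>l<r. \<Sum>w\<in>(#) l ` {w. walk r cls x (?y l) w}. monom (1::complex) (word_maj (i # w)))"
    by (simp only:) (rule sum.UNION_disjoint, auto simp: finite_walks)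
  also have "\<dots> = (\<Sum>l<r. \<Sum>w | walk r cls x (?y l) w. monom 1 (word_maj (i # l # w)))"
    by (subst sum.reindex) (auto simp: comp_def)
  also have "\<dots> = (\<Sum>l<r. ?e l * (\<Sum>w | walk r cls x (?y l) w. monom 1 (word_maj (l # w))))"
  proof (intro sum.cong refl)
    fix l assume l: "l \<in> {..<r}"
    show "(\<Sum>w | walk r cls x (?y l) w. monom 1 (word_maj (i # l # w))) =
      ?e l * (\<Sum>w | walk r cls x (?y l) w. monom 1 (word_maj (l # w)))"
      unfolding sum_distrib_left
    proof (rule sum.cong[OF refl])
      fix w assume "w \<in> {w. walk r cls x (?y l) w}"
      then have "length w = n" using walk_length[of r cls x "?y l" w] sum_y l by simp
      then show "monom 1 (word_maj (i # l # w)) = ?e l * monom (1::complex) (word_maj (l # w))"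
        unfolding mult_monom by simp
    qed
  qed
  also have "\<dots> = (\<Sum>l<r. ?e l * signed_gf r cls x l (?y l))"
    by (intro sum.cong refl) (simp only: IH lessThan_iff)
  also have "\<dots> = (\<Sum>l<r. \<Sum>p\<in>class_perms r cls.
      of_int (sign p) * (?e l * word_gf r l (\<lambda>j. ?y l j - x (p j))))"
    unfolding signed_gf_def sum_distrib_left by (simp only: ac_simps)
  also have "\<dots> = (\<Sum>p\<in>class_perms r cls. of_int (sign p) *
      (\<Sum>l<r. ?e l * word_gf r l (\<lambda>j. ?y l j - x (p j))))"
    by (subst sum.swap) (simp only: sum_distrib_left)
  also have "\<dots> = signed_gf r cls x i y"
    unfolding signed_gf_def
  proof (rule sum.cong[OF refl])
    fix p assume "p \<in> class_perms r cls"
    then have pp: "p permutes {..<r}" by (simp add: class_perms_def)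
    let ?c = "\<lambda>l. y l - x (p l)"
    have "(\<Sum>l<r. x (p l)) = (\<Sum>l<r. x l)"
      using sum.permute[OF pp, of x] by (simp add: comp_def)
    then have "(\<Sum>l<r. ?c l) = int (Suc n)" using Suc.prems by (simp add: sum_subtractf)
    from word_gf_append[OF Suc.prems(2) this]
    have "word_gf r i ?c = (\<Sum>l<r. ?e l * word_gf r l (?c(l := ?c l - 1)))" by simp
    moreover have "?c(l := ?c l - 1) = (\<lambda>j. ?y l j - x (p j))" for l
      by (auto simp: fun_eq_iff)
    ultimately show "of_int (sign p) * (\<Sum>l<r. ?e l * word_gf r l (\<lambda>j. ?y l j - x (p j)))
        = of_int (sign p) * word_gf r i ?c" by simp
  qed
  finally show ?case .
qed

section \<open>Standard tableaux as walks\<close>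

definition row_word :: "(nat \<Rightarrow> nat) \<Rightarrow> nat \<Rightarrow> nat list" where
  "row_word f n = map f (rev [1..<Suc n])"

abbreviation row_count :: "(nat \<Rightarrow> nat) \<Rightarrow> nat \<Rightarrow> nat \<Rightarrow> nat" where
  "row_count f k i \<equiv> count_list (row_word f k) i"

lemma row_word_0 [simp]: "row_word f 0 = []"
  by (simp add: row_word_def)

lemma row_word_Suc [simp]: "row_word f (Suc n) = f (Suc n) # row_word f n"
  by (simp add: row_word_def)

lemma length_row_word [simp]: "length (row_word f n) = n"
  by (simp add: row_word_def)

lemma row_word_eq_iff: "row_word f n = row_word g n \<longleftrightarrow> (\<forall>k\<in>{1..n}. f k = g k)"
  by (auto simp: row_word_def)

lemma list_eq_row_word: "w = row_word (\<lambda>k. rev w ! (k - 1)) (length w)"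
proof -
  have "rev w = map (\<lambda>k. rev w ! (k - 1)) [1..<Suc (length w)]"
    by (rule nth_equalityI) (simp_all add: nth_upt del: upt_Suc)
  then have "w = rev (map (\<lambda>k. rev w ! (k - 1)) [1..<Suc (length w)])"
    by (metis rev_rev_ident)
  then show ?thesis unfolding row_word_def rev_map .
qed

lemma row_count_mono: "k \<le> k' \<Longrightarrow> row_count f k i \<le> row_count f k' i"
  by (induction k' rule: dec_induct) auto

lemma row_count_step: "0 < k \<Longrightarrow> row_count f k (f k) = Suc (row_count f (k - 1) (f k))"
  by (cases k) auto

lemma word_maj_row_word: "word_maj (row_word f n) = \<Sum>{k \<in> {1..<n}. f k < f (Suc k)}"
proof (induction n)
  case (Suc n)
  have "{k \<in> {1..<Suc n}. f k < f (Suc k)} = {k \<in> {1..<n}. f k < f (Suc k)} \<union>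
      (if 0 < n \<and> f n < f (Suc n) then {n} else {})"
    by (auto simp: less_Suc_eq)
  moreover have "word_maj (row_word f (Suc n)) = word_maj (row_word f n) +
      (if 0 < n \<and> f n < f (Suc n) then n else 0)"
    by (cases n) auto
  ultimately show ?case using Suc by (auto simp: sum.union_disjoint)
qed simp

lemma separated_cong:
  "(\<And>i. i < r \<Longrightarrow> y i = z i) \<Longrightarrow> separated r cls y \<longleftrightarrow> separated r cls z"
  unfolding separated_def by (intro all_cong1 imp_cong refl) auto

lemma walk_row_word:
  "walk r cls x y (row_word f n) \<longleftrightarrow>
     (\<forall>k\<in>{1..n}. f k < r \<and> separated r cls (\<lambda>i. x i + int (row_count f k i))) \<and>
     (\<forall>i<r. y i = x i + int (row_count f n i))"
proof (induction n arbitrary: y)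
  case (Suc n)
  let ?l = "f (Suc n)"
  have ends: "(\<forall>i<r. (y(?l := y ?l - 1)) i = x i + int (row_count f n i)) \<longleftrightarrow>
      (\<forall>i<r. y i = x i + int (row_count f (Suc n) i))" (is "?E \<longleftrightarrow> ?E'")
    by (intro all_cong) auto
  have "walk r cls x y (row_word f (Suc n)) \<longleftrightarrow> ?l < r \<and> separated r cls y \<and>
     (\<forall>k\<in>{1..n}. f k < r \<and> separated r cls (\<lambda>i. x i + int (row_count f k i))) \<and> ?E'"
    by (simp only: row_word_Suc walk.simps Suc ends)
  also have "\<dots> \<longleftrightarrow> ?l < r \<and> separated r cls (\<lambda>i. x i + int (row_count f (Suc n) i)) \<and>
     (\<forall>k\<in>{1..n}. f k < r \<and> separated r cls (\<lambda>i. x i + int (row_count f k i))) \<and> ?E'"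
    using separated_cong[of r y "\<lambda>i. x i + int (row_count f (Suc n) i)" cls] by auto
  also have "\<dots> \<longleftrightarrow>
     (\<forall>k\<in>{1..Suc n}. f k < r \<and> separated r cls (\<lambda>i. x i + int (row_count f k i))) \<and> ?E'"
    by (simp only: atLeastAtMostSuc_conv[of 1 n] le_add1 Suc_eq_plus1[symmetric] ball_simps) blast
  finally show ?case .
qed simp

text \<open>
  Subtracting the row index turns weakly decreasing row lengths into strictly decreasing positions.
\<close>

definition row_position :: "(nat \<Rightarrow> nat) \<Rightarrow> nat \<Rightarrow> int" where
  "row_position p i = int (p i) - int i"

definition entry_row :: "(nat \<Rightarrow> nat) \<Rightarrow> (nat \<Rightarrow> nat) \<Rightarrow> (nat \<times> nat \<Rightarrow> nat) \<Rightarrow> nat \<Rightarrow> nat" where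
  "entry_row la mu T k = fst (inv_into (skew_diagram la mu) T k)"

definition tableau_word ::
    "(nat \<Rightarrow> nat) \<Rightarrow> (nat \<Rightarrow> nat) \<Rightarrow> (nat \<times> nat \<Rightarrow> nat) \<Rightarrow> nat list" where
  "tableau_word la mu T = row_word (entry_row la mu T) (card (skew_diagram la mu))"

lemma row_position_separated:
  assumes "int_partition p"
  shows "separated r cls (row_position p)"
  unfolding separated_def row_position_def
proof (intro allI impI)
  fix i j :: nat assume "i < j"
  moreover have "p j \<le> p i"
    using assms \<open>i < j\<close> by (auto simp: int_partition_def monotone_on_def)
  ultimately show "int (p j) - int j < int (p i) - int i" by simp
qed

lemma skew_diagram_Sigma:
  assumes "\<And>i. r \<le> i \<Longrightarrow> la i = 0"
  shows "skew_diagram la mu = Sigma {..<r} (\<lambda>i. {mu i..<la i})"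
proof -
  have "i < r" if "j < la i" for i j
    using assms[of i] that by (cases "r \<le> i") auto
  then show ?thesis by (auto simp: skew_diagram_def)
qed

lemma SYT_D:
  assumes "T \<in> SYT la mu"
  shows "bij_betw T (skew_diagram la mu) {1..card (skew_diagram la mu)}"
    and "\<And>i j j'. (i, j) \<in> skew_diagram la mu \<Longrightarrow> (i, j') \<in> skew_diagram la mu \<Longrightarrow>
        j < j' \<Longrightarrow> T (i, j) < T (i, j')"
    and "\<And>i i' j. (i, j) \<in> skew_diagram la mu \<Longrightarrow> (i', j) \<in> skew_diagram la mu \<Longrightarrow>
        i < i' \<Longrightarrow> T (i, j) < T (i', j)"
    and "T \<in> extensional (skew_diagram la mu)"
  using assms unfolding SYT_def mem_Collect_eq by blast+

lemma SYT_inv: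
  assumes "T \<in> SYT la mu" "k \<in> {1..card (skew_diagram la mu)}"
  shows "inv_into (skew_diagram la mu) T k \<in> skew_diagram la mu"
    and "T (inv_into (skew_diagram la mu) T k) = k"
  using assms SYT_D(1)[OF assms(1)]
  by (metis bij_betw_imp_surj_on inv_into_into f_inv_into_f)+

text \<open>
  The entries up to \<open>k\<close> fill a left-justified part of each row, so the sequence of their rows
  determines where they are.
\<close>

lemma SYT_row_entries:
  assumes T: "T \<in> SYT la mu" and "k \<le> card (skew_diagram la mu)"
  shows "{c. (i, c) \<in> skew_diagram la mu \<and> T (i, c) \<le> k} =
    {mu i..<mu i + row_count (entry_row la mu T) k i}"
  using assms(2)
proof (induction k arbitrary: i)
  case 0
  have "T b \<noteq> 0" if "b \<in> skew_diagram la mu" for b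
    using bij_betwE[OF SYT_D(1)[OF T]] that by fastforce
  then show ?case by auto
next
  case (Suc k)
  let ?D = "skew_diagram la mu" and ?f = "entry_row la mu T"
  have k: "Suc k \<in> {1..card ?D}" using Suc.prems by simp
  define a c where "a = fst (inv_into ?D T (Suc k))" and "c = snd (inv_into ?D T (Suc k))"
  have ac: "(a, c) \<in> ?D" "T (a, c) = Suc k"
    using SYT_inv[OF T k] by (simp_all add: a_def c_def)
  have only: "b = (a, c)" if "b \<in> ?D" "T b = Suc k" for b
    using bij_betw_imp_inj_on[OF SYT_D(1)[OF T]] ac that by (metis inj_onD)
  have fa: "?f (Suc k) = a" by (simp add: entry_row_def a_def)
  note IH = Suc.IH[OF Suc_leD[OF Suc.prems]]
  show ?case
  proof (cases "i = a")
    case False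
    then have "{c. (i, c) \<in> ?D \<and> T (i, c) \<le> Suc k} = {c. (i, c) \<in> ?D \<and> T (i, c) \<le> k}"
      using only by (auto simp: le_Suc_eq)
    then show ?thesis using IH[of i] fa False by simp
  next
    case True
    have step: "{c. (i, c) \<in> ?D \<and> T (i, c) \<le> Suc k} = insert c {c. (i, c) \<in> ?D \<and> T (i, c) \<le> k}"
      using only ac True by (auto simp: le_Suc_eq)
    have "c \<notin> {c. (a, c) \<in> ?D \<and> T (a, c) \<le> k}" using ac by simp
    moreover have "mu a \<le> c" "c < la a" using ac by (auto simp: skew_diagram_def)
    moreover have "{mu a..<c} \<subseteq> {c. (a, c) \<in> ?D \<and> T (a, c) \<le> k}"
    proof
      fix c' assume c': "c' \<in> {mu a..<c}"
      then have D: "(a, c') \<in> ?D" using ac by (auto simp: skew_diagram_def)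
      then have "T (a, c') < T (a, c)" using SYT_D(2)[OF T D ac(1)] c' by simp
      then show "c' \<in> {c. (a, c) \<in> ?D \<and> T (a, c) \<le> k}" using D ac by simp
    qed
    ultimately have "mu a \<le> c" "c \<notin> {mu a..<mu a + row_count ?f k a}"
      "{mu a..<c} \<subseteq> {mu a..<mu a + row_count ?f k a}" unfolding IH by auto
    then have "c = mu a + row_count ?f k a"
      by (auto simp: subset_eq Ball_def not_less dest: spec[of _ "mu a + row_count ?f k a"])
    then show ?thesis unfolding step IH using True fa by auto
  qed
qed

lemma SYT_cell:
  assumes T: "T \<in> SYT la mu" and k: "k \<in> {1..card (skew_diagram la mu)}"
  defines "f \<equiv> entry_row la mu T"
  shows "inv_into (skew_diagram la mu) T k = (f k, mu (f k) + row_count f (k - 1) (f k))"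
proof -
  let ?D = "skew_diagram la mu"
  define c where "c = snd (inv_into ?D T k)"
  have eq: "inv_into ?D T k = (f k, c)" by (simp add: f_def entry_row_def c_def)
  have D: "(f k, c) \<in> ?D" "T (f k, c) = k" using SYT_inv[OF T k] by (simp_all add: eq)
  have "c \<in> {c. (f k, c) \<in> ?D \<and> T (f k, c) \<le> k}"
    "c \<notin> {c. (f k, c) \<in> ?D \<and> T (f k, c) \<le> k - 1}" using D k by auto
  moreover have "k \<le> card ?D" "k - 1 \<le> card ?D" using k by auto
  ultimately have "c \<in> {mu (f k)..<mu (f k) + row_count f k (f k)}"
    "c \<notin> {mu (f k)..<mu (f k) + row_count f (k - 1) (f k)}"
    using SYT_row_entries[OF T] unfolding f_def by auto
  then have "c = mu (f k) + row_count f (k - 1) (f k)"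
    using row_count_step[of k f] k by auto
  then show ?thesis using eq by simp
qed

text \<open>
  If at time \<open>k\<close> a lower row \<open>i'\<close> reached beyond the end of row \<open>i\<close>, then in the column just after
  that end the lower entry would be at most \<open>k\<close> and the upper one larger.
\<close>

lemma tableau_word_walk:
  assumes skew: "skew_shape la mu" and r: "\<And>i. r \<le> i \<Longrightarrow> la i = 0" and T: "T \<in> SYT la mu"
  shows "walk r (\<lambda>_. 0) (row_position mu) (row_position la) (tableau_word la mu T)"
  unfolding tableau_word_def walk_row_word
proof (intro conjI ballI allI impI)
  let ?D = "skew_diagram la mu" and ?f = "entry_row la mu T"
  fix k assume k: "k \<in> {1..card ?D}"
  have D: "?D = Sigma {..<r} (\<lambda>i. {mu i..<la i})" using r by (rule skew_diagram_Sigma)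
  have "inv_into ?D T k \<in> Sigma {..<r} (\<lambda>i. {mu i..<la i})"
    using SYT_inv(1)[OF T k] D by simp
  then show "?f k < r" unfolding entry_row_def by (simp add: mem_Times_iff Sigma_def) auto
  have "mu i' + row_count ?f k i' \<le> mu i + row_count ?f k i" if "i < i'" for i i'
  proof (rule ccontr)
    define c where "c = mu i + row_count ?f k i"
    assume "\<not> ?thesis"
    then have c: "c < mu i' + row_count ?f k i'" by (simp add: c_def)
    have anti: "mu i' \<le> mu i" "la i' \<le> la i"
      using skew that by (auto simp: skew_shape_def int_partition_def monotone_on_def)
    have k': "k \<le> card ?D" using k by simp
    have "c \<in> {mu i'..<mu i' + row_count ?f k i'}" using c anti by (simp add: c_def)
    then have i': "(i', c) \<in> ?D" "T (i', c) \<le> k"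
      unfolding SYT_row_entries[OF T k', symmetric] by auto
    then have i: "(i, c) \<in> ?D" using anti by (auto simp: skew_diagram_def c_def)
    then have "T (i, c) < T (i', c)" using SYT_D(3)[OF T i i'(1) that] by simp
    then have "c \<in> {c. (i, c) \<in> ?D \<and> T (i, c) \<le> k}" using i i' by simp
    then show False unfolding SYT_row_entries[OF T k'] by (simp add: c_def)
  qed
  then show "separated r (\<lambda>_. 0) (\<lambda>i. row_position mu i + int (row_count ?f k i))"
    unfolding separated_def row_position_def by fastforce
next
  let ?D = "skew_diagram la mu" and ?f = "entry_row la mu T"
  fix i
  have "T b \<le> card ?D" if "b \<in> ?D" for b
    using bij_betwE[OF SYT_D(1)[OF T]] that by auto
  then have "{mu i..<mu i + row_count ?f (card ?D) i} = {c. (i, c) \<in> ?D}"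
    unfolding SYT_row_entries[OF T order_refl, symmetric] by auto
  also have "\<dots> = {mu i..<la i}" by (auto simp: skew_diagram_def)
  finally have "card {mu i..<mu i + row_count ?f (card ?D) i} = card {mu i..<la i}" by simp
  then have "row_count ?f (card ?D) i = la i - mu i" by simp
  moreover have "mu i \<le> la i" using skew by (simp add: skew_shape_def)
  ultimately show "row_position la i = row_position mu i + int (row_count ?f (card ?D) i)"
    by (simp add: row_position_def)
qed

lemma inj_on_tableau_word: "inj_on (tableau_word la mu) (SYT la mu)"
proof (rule inj_onI)
  let ?D = "skew_diagram la mu"
  fix T T' assume T: "T \<in> SYT la mu" and T': "T' \<in> SYT la mu"
    and eq: "tableau_word la mu T = tableau_word la mu T'"
  let ?f = "entry_row la mu T" and ?g = "entry_row la mu T'"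
  have fg: "?f k = ?g k" if "k \<in> {1..card ?D}" for k
    using eq that unfolding tableau_word_def row_word_eq_iff by blast
  have inv: "inv_into ?D T k = inv_into ?D T' k" if k: "k \<in> {1..card ?D}" for k
  proof -
    have "row_word ?f (k - 1) = row_word ?g (k - 1)"
      unfolding row_word_eq_iff using fg k by auto
    then show ?thesis unfolding SYT_cell[OF T k] SYT_cell[OF T' k] by (simp add: fg[OF k])
  qed
  show "T = T'"
  proof (rule extensionalityI[OF SYT_D(4)[OF T] SYT_D(4)[OF T']])
    fix b assume b: "b \<in> ?D"
    then have k: "T b \<in> {1..card ?D}" using bij_betwE[OF SYT_D(1)[OF T]] by blast
    have "inv_into ?D T' (T b) = b"
      using inv[OF k] b bij_betw_imp_inj_on[OF SYT_D(1)[OF T]] by simp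
    then show "T b = T' b" using SYT_inv(2)[OF T' k] by simp
  qed
qed

lemma walk_shape_antimono:
  assumes "separated r (\<lambda>_. 0) (\<lambda>i. row_position p i + int (g i))" "i < i'" "i' < r"
  shows "p i' + g i' \<le> p i + g i"
  using assms(2,3)
proof (induction i' rule: less_Suc_induct)
  case (1 i)
  then have "row_position p (Suc i) + int (g (Suc i)) < row_position p i + int (g i)"
    using assms(1) by (simp add: separated_def)
  then show ?case by (simp add: row_position_def)
next
  case (2 i j k)
  then show ?case by simp
qed

text \<open>
  Entry \<open>k\<close> is put at the current end of its row; the columns increase because the rows filled so
  far always have weakly decreasing ends.
\<close>

lemma walk_is_tableau_word:
  assumes skew: "skew_shape la mu" and r: "\<And>i. r \<le> i \<Longrightarrow> la i = 0"
    and w: "walk r (\<lambda>_. 0) (row_position mu) (row_position la) w"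
  shows "w \<in> tableau_word la mu ` SYT la mu"
proof -
  let ?D = "skew_diagram la mu"
  define n where "n = length w"
  obtain f where wf: "w = row_word f n" unfolding n_def using list_eq_row_word by blast
  have mula: "mu i \<le> la i" for i using skew by (simp add: skew_shape_def)
  have D: "?D = Sigma {..<r} (\<lambda>i. {mu i..<la i})" using r by (rule skew_diagram_Sigma)
  have "int n = (\<Sum>i<r. int (la i - mu i))"
    unfolding n_def walk_length[OF w]
    by (rule sum.cong) (use mula in \<open>auto simp: row_position_def\<close>)
  then have n: "n = card ?D"
    unfolding D by (simp flip: of_nat_sum)
  have frow: "f k < r" if "k \<in> {1..n}" for k
    using w that unfolding wf walk_row_word by blast
  have sep: "separated r (\<lambda>_. 0) (\<lambda>i. row_position mu i + int (row_count f k i))"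
    if "k \<in> {1..n}" for k
    using w that unfolding wf walk_row_word by blast
  have total: "mu i + row_count f n i = la i" if "i < r" for i
    using w that unfolding wf walk_row_word by (auto simp: row_position_def)
  define cell where "cell k = (f k, mu (f k) + row_count f (k - 1) (f k))" for k
  have before: "row_count f k i \<le> row_count f (k' - 1) i" if "k < k'" for k k' i
    using that by (intro row_count_mono) simp
  have inj: "inj_on cell {1..n}"
  proof (rule linorder_inj_onI)
    fix k k' assume "k < k'" "k \<in> {1..n}"
    then show "cell k \<noteq> cell k'"
      using row_count_step[of k f] before[of k k' "f k"] by (auto simp: cell_def)
  qed auto
  have "cell ` {1..n} \<subseteq> ?D"
  proof
    fix b assume "b \<in> cell ` {1..n}"
    then obtain k where k: "k \<in> {1..n}" and b: "b = cell k" by blast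
    have "row_count f k (f k) \<le> row_count f n (f k)" using k by (intro row_count_mono) simp
    then have "mu (f k) + row_count f (k - 1) (f k) < la (f k)"
      using row_count_step[of k f] k total[OF frow[OF k]] by simp
    then show "b \<in> ?D" by (simp add: b cell_def skew_diagram_def)
  qed
  moreover have "finite ?D" unfolding D by simp
  ultimately have "cell ` {1..n} = ?D"
    using inj n by (intro card_subset_eq) (auto simp: card_image)
  then have bij: "bij_betw cell {1..n} ?D" using inj by (simp add: bij_betw_def)
  define T where "T = restrict (inv_into {1..n} cell) ?D"
  have T_cell: "T (cell k) = k" if "k \<in> {1..n}" for k
    using that inj bij bij_betwE[OF bij] by (simp add: T_def)
  have cell_T: "T b \<in> {1..n}" "cell (T b) = b" if "b \<in> ?D" for b
  proof -
    have "b \<in> cell ` {1..n}" using that by (simp only: bij_betw_imp_surj_on[OF bij])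
    then obtain k where "k \<in> {1..n}" "b = cell k" by blast
    then show "T b \<in> {1..n}" "cell (T b) = b" using T_cell by auto
  qed
  have bijT: "bij_betw T ?D {1..n}"
    by (rule bij_betw_byWitness[where f' = cell])
      (use T_cell cell_T bij_betwE[OF bij] in auto)
  have "T \<in> SYT la mu"
    unfolding SYT_def mem_Collect_eq n[symmetric]
  proof (intro conjI allI impI)
    show "T \<in> extensional ?D" by (simp add: T_def)
    show "bij_betw T ?D {1..n}" by (rule bijT)
  next
    fix i j j' assume *: "(i, j) \<in> ?D" "(i, j') \<in> ?D" "j < j'"
    define k k' where "k = T (i, j)" and "k' = T (i, j')"
    have k: "k \<in> {1..n}" "cell k = (i, j)" "cell k' = (i, j')"
      using cell_T * by (auto simp: k_def k'_def)
    have "row_count f (k - 1) i < row_count f (k' - 1) i"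
      using k(2,3) *(3) by (auto simp: cell_def)
    then have "\<not> k' - 1 \<le> k - 1" using row_count_mono[of "k' - 1" "k - 1" f i] by linarith
    then show "T (i, j) < T (i, j')" unfolding k_def k'_def by linarith
  next
    fix i i' j assume *: "(i, j) \<in> ?D" "(i', j) \<in> ?D" "i < i'"
    define k k' where "k = T (i, j)" and "k' = T (i', j)"
    have k: "k' \<in> {1..n}" "cell k = (i, j)" "cell k' = (i', j)"
      using cell_T * by (auto simp: k_def k'_def)
    have "k \<noteq> k'" using k(2,3) *(3) by auto
    moreover have "\<not> k' < k"
    proof
      assume "k' < k"
      then have "mu i + row_count f k' i \<le> j"
        using before[of k' k i] k(2) by (auto simp: cell_def)
      moreover have "mu i' + row_count f k' i' = Suc j"
        using row_count_step[of k' f] k(1,3) by (auto simp: cell_def)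
      moreover have "i' < r" using *(2) D by auto
      ultimately show False
        using walk_shape_antimono[OF sep[OF k(1)] *(3)] by simp
    qed
    ultimately show "T (i, j) < T (i', j)" unfolding k_def k'_def by linarith
  qed
  moreover have "tableau_word la mu T = w"
    unfolding tableau_word_def wf n[symmetric] row_word_eq_iff entry_row_def
  proof
    fix k assume k: "k \<in> {1..n}"
    have "inv_into ?D T (T (cell k)) = cell k"
      using bij_betw_imp_inj_on[OF bijT] bij_betwE[OF bij] k by (intro inv_into_f_f) auto
    then show "fst (inv_into ?D T k) = f k" unfolding T_cell[OF k] by (simp add: cell_def)
  qed
  ultimately show ?thesis by blast
qed

lemma bij_betw_tableau_word:
  assumes "skew_shape la mu" "\<And>i. r \<le> i \<Longrightarrow> la i = 0"
  shows "bij_betw (tableau_word la mu) (SYT la mu)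
    {w. walk r (\<lambda>_. 0) (row_position mu) (row_position la) w}"
  unfolding bij_betw_def
  using inj_on_tableau_word tableau_word_walk[OF assms] walk_is_tableau_word[OF assms] by blast

lemma maj_eq_word_maj:
  assumes T: "T \<in> SYT la mu"
  shows "maj la mu T = word_maj (tableau_word la mu T)"
proof -
  let ?D = "skew_diagram la mu" and ?f = "entry_row la mu T"
  have row: "?f (T b) = fst b" if "b \<in> ?D" for b
    using bij_betw_imp_inj_on[OF SYT_D(1)[OF T]] that by (simp add: entry_row_def)
  have "k \<in> descents la mu T \<longleftrightarrow> ?f k < ?f (Suc k)" if k: "k \<in> {1..<card ?D}" for k
  proof
    assume "k \<in> descents la mu T"
    then obtain b b' where "b \<in> ?D" "b' \<in> ?D" "T b = k" "T b' = Suc k" "fst b < fst b'"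
      by (auto simp: descents_def)
    then show "?f k < ?f (Suc k)" using row by metis
  next
    assume less: "?f k < ?f (Suc k)"
    have k': "k \<in> {1..card ?D}" "Suc k \<in> {1..card ?D}" using k by auto
    have "\<exists>b\<in>?D. \<exists>b'\<in>?D. T b = k \<and> T b' = k + 1 \<and> fst b < fst b'"
      using SYT_inv[OF T k'(1)] SYT_inv[OF T k'(2)] less
      by (intro bexI[of _ "inv_into ?D T k"] bexI[of _ "inv_into ?D T (Suc k)"])
        (simp_all add: entry_row_def)
    then show "k \<in> descents la mu T"
      unfolding descents_def using k by blast
  qed
  moreover have "descents la mu T \<subseteq> {1..<card ?D}" by (auto simp: descents_def)
  ultimately have "descents la mu T = {k \<in> {1..<card ?D}. ?f k < ?f (Suc k)}" by blast
  then show ?thesis by (simp add: maj_def tableau_word_def word_maj_row_word)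
qed

section \<open>Counting orbits by Fourier inversion\<close>

lemma card_residue_one:
  assumes z: "primitive_root_of_unity e z" and "finite W"
  shows "of_nat (e * card {w \<in> W. stat w mod e = 1 mod e}) =
    (\<Sum>t<e. inverse z ^ t * (\<Sum>w\<in>W. (z ^ t) ^ stat w))"
proof -
  have "z \<noteq> 0" using primitive_root_nonzero[OF z] .
  have "(\<Sum>t<e. inverse z ^ t * (\<Sum>w\<in>W. (z ^ t) ^ stat w)) =
      (\<Sum>w\<in>W. \<Sum>t<e. inverse z ^ t * (z ^ t) ^ stat w)"
    unfolding sum_distrib_left by (rule sum.swap)
  also have "\<dots> = (\<Sum>w\<in>W. if stat w mod e = 1 mod e then of_nat e else 0)"
  proof (rule sum.cong[OF refl])
    fix w
    let ?y = "z ^ stat w * inverse z"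
    have "(\<Sum>t<e. inverse z ^ t * (z ^ t) ^ stat w) = (\<Sum>t<e. ?y ^ t)"
      by (simp add: power_mult_distrib power_commutes mult.commute flip: power_mult)
    also have "?y ^ e = (z ^ e) ^ stat w * inverse (z ^ e)"
      by (simp add: power_mult_distrib power_inverse mult.commute flip: power_mult)
    then have "?y ^ e = 1" using z by (simp add: primitive_root_of_unity_def)
    note sum_powers_root_of_unity[OF this]
    also have "?y = 1 \<longleftrightarrow> z ^ stat w = z ^ 1" using \<open>z \<noteq> 0\<close> by (simp add: field_simps)
    also have "\<dots> \<longleftrightarrow> stat w mod e = 1 mod e" by (rule primitive_root_power_eq_iff[OF z])
    finally show "(\<Sum>t<e. inverse z ^ t * (z ^ t) ^ stat w) =
      (if stat w mod e = 1 mod e then of_nat e else 0)" .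
  qed
  also have "\<dots> = of_nat (e * card {w \<in> W. stat w mod e = 1 mod e})"
    using \<open>finite W\<close> by (simp add: sum.If_cases Int_def mult.commute)
  finally show ?thesis by simp
qed

lemma inverse_unit_root_power:
  "inverse (unit_root e) ^ t = cis (- (2 * pi * (real t / real e)))"
  by (simp add: unit_root_power power_inverse)

text \<open>
  The pairs of a divisor \<open>e\<close> of \<open>d\<close> and \<open>t < e\<close> are fractions \<open>t / e\<close>, not necessarily reduced. They
  are regrouped by \<open>g = gcd t e\<close>: those with a given \<open>g\<close> correspond, by \<open>t / e = u / (d / g)\<close>, to
  all \<open>u < d / g\<close>. The roots of unity of such a group sum to zero unless \<open>g = d\<close>.
\<close>

lemma sum_divisors_fourier:
  assumes "0 < d"
  shows "(\<Sum>e | e dvd d. \<Sum>t<e. inverse (unit_root e) ^ t * F (gcd t e)) = F d"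
proof -
  let ?A = "Sigma {e. e dvd d} lessThan" and ?B = "Sigma {g. g dvd d} (\<lambda>g. {..<d div g})"
  let ?fwd = "\<lambda>(e, t). (gcd t e, t div gcd t e * (d div e))"
  let ?bwd = "\<lambda>(g, u). (g * (d div g div gcd u (d div g)), g * (u div gcd u (d div g)))"
  have fin: "finite {e. e dvd d}" using assms by simp
  have fwd: "?fwd a \<in> ?B \<and> ?bwd (?fwd a) = a \<and>
      (case ?fwd a of (g, u) \<Rightarrow> inverse (unit_root (d div g)) ^ u * F g) =
      (case a of (e, t) \<Rightarrow> inverse (unit_root e) ^ t * F (gcd t e))" if A: "a \<in> ?A" for a
  proof -
    obtain e t where a: "a = (e, t)" "e dvd d" "t < e" using A by (cases a) auto
    have "gcd t e \<noteq> 0" using a by auto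
    define g where "g = gcd t e"
    obtain t' e' where te: "t = t' * g" "e = e' * g" "coprime t' e'"
      using gcd_coprime_exists[OF \<open>gcd t e \<noteq> 0\<close>] unfolding g_def by blast
    obtain q where q: "d = e * q" using a(2) by blast
    have pos: "0 < g" "0 < q" "0 < e'" using assms te(2) q by auto
    have fwd: "?fwd a = (g, t' * q)"
      unfolding a(1) prod.case g_def[symmetric] using pos te q by simp
    have d: "d div g = e' * q" using q te pos by simp
    have "gcd (t' * q) (e' * q) = q"
      using te(3) by (simp add: gcd_mult_right coprime_iff_gcd_eq_1 gcd.commute)
    then have bwd: "?bwd (g, t' * q) = a"
      unfolding prod.case d a(1) using pos te by (simp add: mult.commute)
    have "g dvd d" using te q by simp
    moreover have "t' < e'" using a(3) te pos by simp
    ultimately have mem: "(g, t' * q) \<in> ?B" using d pos by simp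
    have "real (t' * q) / real (e' * q) = real t / real e"
      using pos te by simp
    then have w: "inverse (unit_root (d div g)) ^ (t' * q) = inverse (unit_root e) ^ t"
      unfolding inverse_unit_root_power d by (simp only:)
    show ?thesis unfolding fwd
    proof (intro conjI)
      show "(case (g, t' * q) of (g, u) \<Rightarrow> inverse (unit_root (d div g)) ^ u * F g) =
        (case a of (e, t) \<Rightarrow> inverse (unit_root e) ^ t * F (gcd t e))"
        by (simp only: prod.case a(1) w g_def[symmetric])
    qed (fact mem bwd)+
  qed
  have bwd: "?bwd b \<in> ?A \<and> ?fwd (?bwd b) = b" if B: "b \<in> ?B" for b
  proof -
    obtain g u where b: "b = (g, u)" "g dvd d" "u < d div g" using B by (cases b) auto
    define D where "D = d div g"
    have dg: "d = g * D" using b(2) by (simp add: D_def)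
    define q where "q = gcd u D"
    have "gcd u D \<noteq> 0" using assms dg by auto
    then obtain u' D' where uD: "u = u' * q" "D = D' * q" "coprime u' D'"
      using gcd_coprime_exists[of u D] unfolding q_def by blast
    have pos: "0 < g" "0 < q" "0 < D'" using assms dg uD by auto
    have bwd: "?bwd b = (g * D', g * u')"
      unfolding b(1) prod.case D_def[symmetric] q_def[symmetric] using pos uD by simp
    have g: "gcd (g * u') (g * D') = g"
      using uD(3) by (simp add: gcd_mult_left coprime_iff_gcd_eq_1)
    have "?fwd (g * D', g * u') = b"
      unfolding prod.case g b(1) using dg uD pos by simp
    moreover have "u' < D'" using b(3) uD pos by (simp add: D_def[symmetric])
    ultimately show ?thesis unfolding bwd using dg uD pos by simp
  qed
  have "(\<Sum>e | e dvd d. \<Sum>t<e. inverse (unit_root e) ^ t * F (gcd t e)) =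
      (\<Sum>(e, t)\<in>?A. inverse (unit_root e) ^ t * F (gcd t e))"
    by (rule sum.Sigma) (use fin in auto)
  also have "\<dots> = (\<Sum>(g, u)\<in>?B. inverse (unit_root (d div g)) ^ u * F g)"
    by (rule sum.reindex_bij_witness[where i = ?bwd and j = ?fwd]) (use fwd bwd in blast)+
  also have "\<dots> = (\<Sum>g | g dvd d. (\<Sum>u<d div g. inverse (unit_root (d div g)) ^ u) * F g)"
    unfolding sum_distrib_right by (rule sum.Sigma[symmetric]) (use fin in auto)
  also have "\<dots> = (\<Sum>g | g dvd d. if g = d then F d else 0)"
  proof (rule sum.cong[OF refl])
    fix g assume "g \<in> {g. g dvd d}"
    then have g: "g * (d div g) = d" by simp
    define D where "D = d div g"
    have D: "0 < D" using g assms unfolding D_def by (cases "d div g") auto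
    have prim: "primitive_root_of_unity D (inverse (unit_root D))"
      by (rule primitive_root_inverse[OF primitive_unit_root[OF D]])
    have "inverse (unit_root D) = 1 \<longleftrightarrow> D = 1"
      using prim power_one_right[of "inverse (unit_root D)"]
      unfolding primitive_root_of_unity_iff by (metis nat_dvd_1_iff_1)
    then have "(\<Sum>u<D. inverse (unit_root D) ^ u) = (if D = 1 then 1 else 0)"
      using sum_powers_root_of_unity[of "inverse (unit_root D)" D] prim
      by (auto simp: primitive_root_of_unity_def)
    moreover have "D = 1 \<longleftrightarrow> g = d" using g D assms by (auto simp: D_def)
    ultimately show "(\<Sum>u<d div g. inverse (unit_root (d div g)) ^ u) * F g =
        (if g = d then F d else 0)" unfolding D_def[symmetric] by simp
  qed
  also have "\<dots> = F d" using fin by (simp add: sum.delta)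
  finally show ?thesis .
qed

section \<open>Permutations with prescribed cycles\<close>

text \<open>
  The permutation is transported from the rotation of a disjoint union of \<open>N e\<close> copies of the
  integers modulo \<open>e\<close>, for each divisor \<open>e\<close> of \<open>m\<close>. Its power \<open>t\<close> fixes a cycle of length \<open>e\<close>
  pointwise if \<open>e dvd t\<close>, and otherwise moves all its points.
\<close>

lemma cycles_power_fixpoints:
  fixes N :: "nat \<Rightarrow> nat"
  assumes X: "finite X" "card X = (\<Sum>e | e dvd m. e * N e)" and m: "0 < m"
  obtains \<rho> where "\<rho> \<in> carrier (BijGroup X)" "\<rho> [^]\<^bsub>BijGroup X\<^esub> m = \<one>\<^bsub>BijGroup X\<^esub>"
    "\<And>t::nat. card {x \<in> X. (\<rho> [^]\<^bsub>BijGroup X\<^esub> t) x = x} = (\<Sum>e | e dvd m \<and> e dvd t. e * N e)"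
proof -
  define Y where "Y = Sigma {e. e dvd m} (\<lambda>e. {..<N e} \<times> {..<e})"
  define s :: "nat \<Rightarrow> nat \<times> nat \<times> nat \<Rightarrow> nat \<times> nat \<times> nat"
    where "s t = (\<lambda>(e, a, b). (e, a, (b + t) mod e))" for t
  have fin: "finite {e. e dvd m \<and> P e}" for P
    by (rule finite_subset[of _ "{e. e dvd m}"]) (use m in auto)
  have finY: "finite Y" unfolding Y_def using fin[of "\<lambda>_. True"] by auto
  have cardY: "card (Sigma {e. e dvd m \<and> P e} (\<lambda>e. {..<N e} \<times> {..<e})) =
      (\<Sum>e | e dvd m \<and> P e. e * N e)" for P
    using fin by (simp add: card_SigmaI mult.commute)
  have "card X = card Y" using cardY[of "\<lambda>_. True"] X(2) by (simp add: Y_def)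
  then obtain h where h: "bij_betw h X Y"
    using finite_same_card_bij[OF X(1) finY] by blast
  define h' where "h' = inv_into X h"
  have h': "bij_betw h' Y X" unfolding h'_def by (rule bij_betw_inv_into[OF h])
  have hh': "h (h' y) = y" if "y \<in> Y" for y
    unfolding h'_def using h that by (rule bij_betw_inv_into_right)
  have h'h: "h' (h x) = x" if "x \<in> X" for x
    unfolding h'_def using h that by (rule bij_betw_inv_into_left)
  have hX: "h x \<in> Y" if "x \<in> X" for x using bij_betwE[OF h] that by blast
  have sY: "s t y \<in> Y" if "y \<in> Y" for t y using that m by (auto simp: Y_def s_def)
  have s_add: "s t (s u y) = s (t + u) y" if "y \<in> Y" for t u y
    using that by (auto simp: Y_def s_def mod_add_left_eq mod_add_right_eq ac_simps)
  have s_fix: "s t y = y \<longleftrightarrow> fst y dvd t" if y: "y \<in> Y" for t y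
  proof -
    obtain e a b where y: "y = (e, a, b)" "b < e" using y by (auto simp: Y_def)
    have "(b + t) mod e = b \<longleftrightarrow> (b + t) mod e = b mod e" using y by simp
    also have "\<dots> \<longleftrightarrow> e dvd t" by (simp add: mod_eq_dvd_iff_nat)
    finally show ?thesis using y by (simp add: s_def)
  qed
  have s_m: "s (t * m) y = y" if "y \<in> Y" for t y
    unfolding s_fix[OF that] using that by (auto simp: Y_def)
  \<comment> \<open>All powers are defined at once, so that inverses are at hand.\<close>
  define \<rho> where "\<rho> t = restrict (\<lambda>x. h' (s t (h x))) X" for t
  have \<rho>X: "\<rho> t x \<in> X" if "x \<in> X" for t x
    using that bij_betwE[OF h'] sY hX by (simp add: \<rho>_def)
  have \<rho>_add: "\<rho> t (\<rho> u x) = \<rho> (t + u) x" if "x \<in> X" for t u x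
    using that \<rho>X[OF that] hh' sY hX s_add by (simp add: \<rho>_def)
  have \<rho>_m: "\<rho> (t * m) x = x" if "x \<in> X" for t x
    using that s_m hX h'h by (simp add: \<rho>_def)
  have \<rho>_Bij: "\<rho> t \<in> carrier (BijGroup X)" for t
  proof -
    have "t + (m - 1) * t = t * m" using m by (cases m) (simp_all add: algebra_simps)
    then have "bij_betw (\<rho> t) X X"
      by (intro bij_betw_byWitness[where f' = "\<rho> ((m - 1) * t)"])
        (use \<rho>X \<rho>_add \<rho>_m in \<open>auto simp: add.commute\<close>)
    then show ?thesis by (simp add: BijGroup_def Bij_def \<rho>_def)
  qed
  interpret group "BijGroup X" by (rule group_BijGroup)
  have pow: "\<rho> 1 [^]\<^bsub>BijGroup X\<^esub> t = \<rho> t" for t :: nat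
  proof (induction t)
    case 0
    have "\<rho> 0 x = x" if "x \<in> X" for x using \<rho>_m[of x 0] that by simp
    then show ?case by (auto simp: BijGroup_def \<rho>_def fun_eq_iff)
  next
    case (Suc t)
    have "\<rho> 1 [^]\<^bsub>BijGroup X\<^esub> Suc t = \<rho> t \<otimes>\<^bsub>BijGroup X\<^esub> \<rho> 1"
      by (simp only: nat_pow_Suc Suc)
    also have "\<dots> = compose X (\<rho> t) (\<rho> 1)"
      using \<rho>_Bij by (simp add: BijGroup_def)
    also have "\<dots> = \<rho> (Suc t)"
    proof
      fix x show "compose X (\<rho> t) (\<rho> 1) x = \<rho> (Suc t) x"
      proof (cases "x \<in> X")
        case True
        then show ?thesis using \<rho>_add[OF True, of t 1] by (simp add: compose_def)
      qed (simp add: compose_def \<rho>_def)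
    qed
    finally show ?case .
  qed
  show ?thesis
  proof (rule that[of "\<rho> 1"])
    show "\<rho> 1 \<in> carrier (BijGroup X)" by (rule \<rho>_Bij)
    show "\<rho> 1 [^]\<^bsub>BijGroup X\<^esub> m = \<one>\<^bsub>BijGroup X\<^esub>"
      unfolding pow using \<rho>_m[where t = 1] by (auto simp: BijGroup_def \<rho>_def fun_eq_iff)
    fix t :: nat
    show "card {x \<in> X. (\<rho> 1 [^]\<^bsub>BijGroup X\<^esub> t) x = x} = (\<Sum>e | e dvd m \<and> e dvd t. e * N e)"
    proof -
      have "\<rho> t x = x \<longleftrightarrow> s t (h x) = h x" if "x \<in> X" for x
        using that hX sY hh' h'h by (metis \<rho>_def restrict_apply')
      then have "h ` {x \<in> X. \<rho> t x = x} = {y \<in> Y. s t y = y}"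
        using bij_betw_imp_surj_on[OF h] by auto
      moreover have "inj_on h {x \<in> X. \<rho> t x = x}"
        using bij_betw_imp_inj_on[OF h] by (rule inj_on_subset) auto
      ultimately have "card {x \<in> X. \<rho> t x = x} = card {y \<in> Y. s t y = y}"
        using card_image[of h "{x \<in> X. \<rho> t x = x}"] by simp
      also have "{y \<in> Y. s t y = y} = {y \<in> Y. fst y dvd t}"
        using s_fix by blast
      also have "\<dots> = Sigma {e. e dvd m \<and> e dvd t} (\<lambda>e. {..<N e} \<times> {..<e})"
        by (auto simp: Y_def)
      finally show ?thesis unfolding pow cardY .
    qed
  qed
qed

section \<open>Values of quotients at roots of unity\<close>

definition multinomial_value :: "nat \<Rightarrow> (nat \<Rightarrow> int) \<Rightarrow> complex" where
  "multinomial_value r c = (if \<forall>l<r. 0 \<le> c l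
     then fact (\<Sum>l<r. nat (c l)) / (\<Prod>l<r. fact (nat (c l))) else 0)"

text \<open>
  The value of the determinantal formula at a root of unity of order \<open>k\<close>. Its form, in which \<open>k\<close>
  occurs only through division of the differences, makes the values of all quotients comparable.
\<close>

definition root_value :: "nat \<Rightarrow> (nat \<Rightarrow> int) \<Rightarrow> (nat \<Rightarrow> int) \<Rightarrow> nat \<Rightarrow> complex" where
  "root_value r x y k =
     (\<Sum>p | p permutes {..<r} \<and> (\<forall>l<r. int k dvd y l - x (p l)).
        of_int (sign p) * multinomial_value r (\<lambda>l. (y l - x (p l)) div int k))"

lemma poly_word_gf_at_root:
  assumes z: "primitive_root_of_unity j z" and j: "int j dvd (\<Sum>l<r. c l)"
  shows "poly (word_gf r 0 c) z =
    (if \<forall>l<r. int j dvd c l then multinomial_value r (\<lambda>l. c l div int j) else 0)"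
proof -
  have j0: "0 < j" using z by (simp add: primitive_root_of_unity_def)
  have sign: "0 \<le> c l div int j \<longleftrightarrow> 0 \<le> c l" for l
    using j0 by (simp add: pos_imp_zdiv_nonneg_iff)
  show ?thesis
  proof (cases "\<forall>l<r. 0 \<le> c l")
    case True
    have "int (\<Sum>l<r. nat (c l)) = (\<Sum>l<r. c l)"
      unfolding of_nat_sum by (rule sum.cong) (use True in auto)
    then have "j dvd (\<Sum>l<r. nat (c l))" using j by (metis int_dvd_int_iff)
    note val = poly_qmultinomial_at_root[OF z this]
    have "j dvd nat (c l) \<longleftrightarrow> int j dvd c l" if "l < r" for l
      using True that by (metis int_dvd_int_iff int_nat_eq)
    then have dvd: "(\<forall>l<r. j dvd nat (c l)) \<longleftrightarrow> (\<forall>l<r. int j dvd c l)" by blast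
    have div: "nat (c l) div j = nat (c l div int j)" if "l < r" for l
      using True that by (simp add: nat_div_distrib)
    have sums: "(\<Sum>l<r. nat (c l) div j) = (\<Sum>l<r. nat (c l div int j))"
      "(\<Prod>l<r. fact (nat (c l) div j)) = (\<Prod>l<r. fact (nat (c l div int j)) :: complex)"
      using div by (auto intro!: sum.cong prod.cong)
    have "poly (word_gf r 0 c) z = poly (qmultinomial r (\<lambda>l. nat (c l))) z"
      using True by (simp add: word_gf_def poly_monom)
    then show ?thesis
      unfolding val dvd multinomial_value_def sign sums using True by simp
  next
    case False
    then show ?thesis unfolding word_gf_def multinomial_value_def sign by auto
  qed
qed

text \<open>
  Passing to the \<open>k\<close>-quotient selects the permutations for which the differences \<open>y l - x (p l)\<close> are
  divisible by \<open>k\<close>, and evaluation at \<open>z\<close> those for which these differences, divided by \<open>k\<close>, are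
  divisible by \<open>j\<close>. Together this is divisibility by \<open>k * j\<close>.
\<close>

lemma quotient_walks_at_root:
  fixes x y :: "nat \<Rightarrow> int"
  assumes x: "separated r (\<lambda>_. 0) x" and y: "separated r (\<lambda>_. 0) y"
    and le: "\<And>l. l < r \<Longrightarrow> x l \<le> y l"
    and dvd: "\<And>l. l < r \<Longrightarrow> int (k * j) dvd y l - x l" and k: "0 < k"
    and z: "primitive_root_of_unity j z"
  shows "(\<Sum>w | walk r (\<lambda>l. x l mod int k) (\<lambda>l. x l div int k) (\<lambda>l. y l div int k) w.
    z ^ word_maj w) = root_value r x y (k * j)"
proof -
  define cls x' y' where "cls = (\<lambda>l. x l mod int k)" and "x' = (\<lambda>l. x l div int k)"
    and "y' = (\<lambda>l. y l div int k)"
  have kj: "int k dvd int (k * j)" by simp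
  have kd: "int k dvd y l - x l" if "l < r" for l
    using dvd_trans[OF kj dvd[OF that]] .
  have ymod: "y l mod int k = cls l" if "l < r" for l
    using kd[OF that] by (simp add: cls_def mod_eq_dvd_iff)
  have lift: "u div int k < v div int k" if "u mod int k = v mod int k" "u < v" for u v :: int
  proof -
    have "int k * (u div int k) < int k * (v div int k)"
      using that by (metis add_less_cancel_right mult_div_mod_eq)
    then show ?thesis using k by simp
  qed
  have x': "separated r cls x'"
    using x lift unfolding separated_def cls_def x'_def by simp
  have y': "separated r cls y'"
    unfolding separated_def
  proof (intro allI impI)
    fix i l assume il: "i < l" "l < r" "cls i = cls l"
    then have "y l mod int k = y i mod int k" using ymod by simp
    moreover have "y l < y i" using y il by (simp add: separated_def)
    ultimately show "y' l < y' i" unfolding y'_def by (rule lift)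
  qed
  have "(\<Sum>l<r. y' l - x' l) \<ge> 0"
    using le k by (intro sum_nonneg) (simp add: x'_def y'_def zdiv_mono1)
  then obtain n where n: "(\<Sum>l<r. y' l - x' l) = int n" using nonneg_int_cases by blast
  have diff: "int k * (y' l - x' (p l)) = y l - x (p l)"
    if "p \<in> class_perms r cls" "l < r" for p l
  proof -
    have "x (p l) mod int k = y l mod int k"
      using that ymod[OF that(2)] by (simp add: class_perms_def cls_def)
    then show ?thesis
      unfolding x'_def y'_def right_diff_distrib minus_mod_eq_mult_div[symmetric] by simp
  qed
  have "(\<Sum>w | walk r cls x' y' w. z ^ word_maj w) =
      poly (\<Sum>w | walk r cls x' y' w. monom 1 (word_maj (0 # w))) z"
    by (simp add: poly_sum poly_monom)
  also have "\<dots> = poly (signed_gf r cls x' 0 y') z"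
    by (simp only: walk_gf_append[OF x' y' le0 n])
  also have "\<dots> = (\<Sum>p\<in>class_perms r cls.
      of_int (sign p) * poly (word_gf r 0 (\<lambda>l. y' l - x' (p l))) z)"
    by (simp add: signed_gf_def poly_sum)
  also have "\<dots> = (\<Sum>p\<in>class_perms r cls. if \<forall>l<r. int (k * j) dvd y l - x (p l)
      then of_int (sign p) * multinomial_value r (\<lambda>l. (y l - x (p l)) div int (k * j)) else 0)"
  proof (rule sum.cong[OF refl])
    fix p assume p: "p \<in> class_perms r cls"
    let ?c = "\<lambda>l. y' l - x' (p l)"
    have "(\<Sum>l<r. x (p l)) = (\<Sum>l<r. x l)"
      using p sum.permute[of p "{..<r}" x] by (simp add: class_perms_def comp_def)
    then have "(\<Sum>l<r. y l - x (p l)) = (\<Sum>l<r. y l - x l)" by (simp add: sum_subtractf)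
    moreover have "int k * (\<Sum>l<r. ?c l) = (\<Sum>l<r. y l - x (p l))"
      unfolding sum_distrib_left by (rule sum.cong) (simp_all add: diff[OF p])
    moreover have "int (k * j) dvd (\<Sum>l<r. y l - x l)" using dvd by (intro dvd_sum) simp
    ultimately have "int k * int j dvd int k * (\<Sum>l<r. ?c l)" by simp
    then have jc: "int j dvd (\<Sum>l<r. ?c l)" using k by simp
    have dvd_c: "int j dvd ?c l \<longleftrightarrow> int (k * j) dvd y l - x (p l)" if "l < r" for l
      using k by (simp flip: diff[OF p that])
    have div_c: "?c l div int j = (y l - x (p l)) div int (k * j)" if "l < r" for l
      using k by (simp flip: diff[OF p that])
    have "multinomial_value r (\<lambda>l. ?c l div int j) =
        multinomial_value r (\<lambda>l. (y l - x (p l)) div int (k * j))"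
      unfolding multinomial_value_def using div_c by simp
    moreover have "(\<forall>l<r. int j dvd ?c l) \<longleftrightarrow> (\<forall>l<r. int (k * j) dvd y l - x (p l))"
      using dvd_c by blast
    ultimately show "of_int (sign p) * poly (word_gf r 0 ?c) z =
        (if \<forall>l<r. int (k * j) dvd y l - x (p l)
         then of_int (sign p) * multinomial_value r (\<lambda>l. (y l - x (p l)) div int (k * j)) else 0)"
      by (simp only: poly_word_gf_at_root[OF z jc] if_distrib[of "(*) _"] mult_zero_right)
  qed
  also have "\<dots> = (\<Sum>p | p \<in> class_perms r cls \<and> (\<forall>l<r. int (k * j) dvd y l - x (p l)).
      of_int (sign p) * multinomial_value r (\<lambda>l. (y l - x (p l)) div int (k * j)))"
    by (rule sum.inter_filter[OF finite_class_perms, symmetric])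
  also have "{p. p \<in> class_perms r cls \<and> (\<forall>l<r. int (k * j) dvd y l - x (p l))} =
      {p. p permutes {..<r} \<and> (\<forall>l<r. int (k * j) dvd y l - x (p l))}"
  proof -
    have "cls (p l) = cls l" if "l < r" "int (k * j) dvd y l - x (p l)" for p l
    proof -
      have "int k dvd y l - x (p l)" using dvd_trans[OF kj that(2)] .
      then have "y l mod int k = x (p l) mod int k" by (simp add: mod_eq_dvd_iff)
      then show ?thesis using ymod[OF that(1)] by (simp add: cls_def)
    qed
    then show ?thesis unfolding class_perms_def by blast
  qed
  finally show ?thesis unfolding root_value_def cls_def x'_def y'_def .
qed

lemma poly_fake_degree:
  "poly (map_poly of_nat (fake_degree la mu)) z = (\<Sum>T\<in>SYT la mu. z ^ maj la mu T :: complex)"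
proof -
  have "map_poly of_nat (fake_degree la mu) =
      (\<Sum>T\<in>SYT la mu. monom (1::complex) (maj la mu T))"
    by (rule poly_eqI) (simp add: fake_degree_def coeff_map_poly coeff_sum if_distrib cong: if_cong)
  then show ?thesis by (simp add: poly_sum poly_monom)
qed

lemma fake_degree_at_root:
  assumes skew: "skew_shape la mu" and r: "\<And>i. r \<le> i \<Longrightarrow> la i = 0"
    and rows: "\<And>i. m dvd la i - mu i" and "j dvd m" and z: "primitive_root_of_unity j z"
  shows "poly (map_poly of_nat (fake_degree la mu)) z =
    root_value r (row_position mu) (row_position la) j"
proof -
  let ?W = "{w. walk r (\<lambda>_. 0) (row_position mu) (row_position la) w}"
  have mula: "mu i \<le> la i" for i using skew by (simp add: skew_shape_def)
  have bij: "bij_betw (tableau_word la mu) (SYT la mu) ?W"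
    using skew r by (rule bij_betw_tableau_word)
  have "poly (map_poly of_nat (fake_degree la mu)) z =
      (\<Sum>T\<in>SYT la mu. z ^ word_maj (tableau_word la mu T))"
    unfolding poly_fake_degree by (rule sum.cong) (simp_all add: maj_eq_word_maj)
  also have "\<dots> = (\<Sum>w\<in>?W. z ^ word_maj w)"
    by (rule sum.reindex_bij_betw[OF bij])
  also have "\<dots> = root_value r (row_position mu) (row_position la) (1 * j)"
  proof -
    have dvd: "int (1 * j) dvd row_position la l - row_position mu l" for l
    proof -
      have "j dvd la l - mu l" using rows \<open>j dvd m\<close> dvd_trans by blast
      then have "int j dvd int (la l - mu l)" by simp
      then show ?thesis using mula[of l] by (simp add: row_position_def)
    qed
    have sep: "separated r (\<lambda>_. 0) (row_position mu)" "separated r (\<lambda>_. 0) (row_position la)"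
      using skew by (auto simp: skew_shape_def intro: row_position_separated)
    have le: "row_position mu l \<le> row_position la l" for l
      using mula[of l] by (simp add: row_position_def)
    show ?thesis
      using quotient_walks_at_root[OF sep le dvd zero_less_one z] by simp
  qed
  finally show ?thesis by simp
qed

text \<open>
  The numbers of orbits. That \<open>N e\<close> is a natural number is the heart of the matter: it is a number of
  walks, the one that extracts the coefficient of exponent 1 modulo \<open>e\<close> from the generating function
  of the \<open>m div e\<close>-quotient. This residue is the one whose Fourier coefficients give the Moebius
  inversion.
\<close>

lemma root_value_orbit_counts:
  assumes x: "separated r (\<lambda>_. 0) x" and y: "separated r (\<lambda>_. 0) y"
    and le: "\<And>l. l < r \<Longrightarrow> x l \<le> y l"
    and dvd: "\<And>l. l < r \<Longrightarrow> int m dvd y l - x l" and m: "0 < m"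
  obtains N :: "nat \<Rightarrow> nat" where
    "\<And>d. d dvd m \<Longrightarrow> of_nat (\<Sum>e | e dvd d. e * N e) = root_value r x y (m div d)"
proof -
  define W where "W e = {w. walk r (\<lambda>l. x l mod int (m div e)) (\<lambda>l. x l div int (m div e))
    (\<lambda>l. y l div int (m div e)) w}" for e
  define N where "N e = card {w \<in> W e. word_maj w mod e = 1 mod e}" for e
  let ?F = "\<lambda>g. root_value r x y (m div g)"
  have N: "of_nat (e * N e) = (\<Sum>t<e. inverse (unit_root e) ^ t * ?F (gcd t e))"
    if e: "e dvd m" for e
  proof -
    have e0: "0 < e" using e m by (auto intro: Nat.gr0I)
    have k0: "0 < m div e" using e m e0 by (simp add: dvd_imp_le div_greater_zero_iff)
    note prim = primitive_unit_root[OF e0]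
    have "of_nat (e * N e) =
        (\<Sum>t<e. inverse (unit_root e) ^ t * (\<Sum>w\<in>W e. (unit_root e ^ t) ^ word_maj w))"
      unfolding N_def by (rule card_residue_one[OF prim]) (simp add: W_def finite_walks)
    also have "\<dots> = (\<Sum>t<e. inverse (unit_root e) ^ t * ?F (gcd t e))"
    proof (intro sum.cong refl arg_cong2[where f = "(*)"])
      fix t
      let ?g = "gcd t e"
      have km: "m div e * (e div ?g) = m div ?g"
        using e e0 by (metis dvd_div_mult gcd_dvd2 dvd_mult_div_cancel mult.commute div_mult_swap)
      moreover have "m div ?g dvd m"
        using e by (metis dvd_div_mult_self dvd_triv_left dvd_trans gcd_dvd2)
      ultimately have "int (m div e * (e div ?g)) dvd y l - x l" if "l < r" for l
        using dvd[OF that] by (metis dvd_trans int_dvd_int_iff)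
      from quotient_walks_at_root[OF x y le this k0 primitive_root_power[OF prim]]
      show "(\<Sum>w\<in>W e. (unit_root e ^ t) ^ word_maj w) = ?F ?g"
        unfolding W_def km by simp
    qed
    finally show ?thesis .
  qed
  have "of_nat (\<Sum>e | e dvd d. e * N e) = ?F d" if d: "d dvd m" for d
  proof -
    have "0 < d" using d m by (auto intro: Nat.gr0I)
    have "of_nat (\<Sum>e | e dvd d. e * N e) =
        (\<Sum>e | e dvd d. \<Sum>t<e. inverse (unit_root e) ^ t * ?F (gcd t e))"
      unfolding of_nat_sum by (intro sum.cong refl N) (use d in \<open>auto intro: dvd_trans\<close>)
    also have "\<dots> = ?F d" by (rule sum_divisors_fourier[OF \<open>0 < d\<close>])
    finally show ?thesis .
  qed
  then show thesis by (rule that)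
qed

lemma group_action_of_power_eq_one:
  assumes \<rho>: "\<rho> \<in> carrier (BijGroup X)" "\<rho> [^]\<^bsub>BijGroup X\<^esub> m = \<one>\<^bsub>BijGroup X\<^esub>" and "0 < m"
  shows "group_action (integer_mod_group m) X (\<lambda>k. \<rho> [^]\<^bsub>BijGroup X\<^esub> k)"
    and "\<rho> [^]\<^bsub>BijGroup X\<^esub> (d mod int m) = \<rho> [^]\<^bsub>BijGroup X\<^esub> (d::int)"
proof -
  interpret group "BijGroup X" by (rule group_BijGroup)
  have red: "\<rho> [^]\<^bsub>BijGroup X\<^esub> (d mod int m) = \<rho> [^]\<^bsub>BijGroup X\<^esub> d" for d :: int
  proof -
    have "\<rho> [^]\<^bsub>BijGroup X\<^esub> d = \<rho> [^]\<^bsub>BijGroup X\<^esub> (int m * (d div int m) + d mod int m)"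
      by simp
    also have "\<dots> = (\<rho> [^]\<^bsub>BijGroup X\<^esub> int m) [^]\<^bsub>BijGroup X\<^esub> (d div int m)
        \<otimes>\<^bsub>BijGroup X\<^esub> \<rho> [^]\<^bsub>BijGroup X\<^esub> (d mod int m)"
      by (simp only: int_pow_mult[OF \<rho>(1)] int_pow_pow[OF \<rho>(1)])
    also have "\<dots> = \<rho> [^]\<^bsub>BijGroup X\<^esub> (d mod int m)"
      using \<rho> by (simp add: int_pow_int)
    finally show ?thesis by simp
  qed
  show "\<rho> [^]\<^bsub>BijGroup X\<^esub> (d mod int m) = \<rho> [^]\<^bsub>BijGroup X\<^esub> d" by (rule red)
  have "(\<lambda>k. \<rho> [^]\<^bsub>BijGroup X\<^esub> k) \<in> hom (integer_mod_group m) (BijGroup X)"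
    by (rule homI) (use \<rho>(1) in \<open>simp_all add: red int_pow_mult\<close>)
  then show "group_action (integer_mod_group m) X (\<lambda>k. \<rho> [^]\<^bsub>BijGroup X\<^esub> k)"
    by (intro group_action.intro group_hom.intro group_hom_axioms.intro)
      (simp_all add: group_BijGroup)
qed

section \<open>Cyclic sieving\<close>

theorem theorem46:
  fixes m :: nat and la mu :: "nat \<Rightarrow> nat"
  assumes "0 < m"
    and "skew_shape la mu"
    and "\<And>i. m dvd card (row_boxes la mu i)"
  shows "\<exists>\<phi> \<rho>. group_action (integer_mod_group m) (SYT la mu) \<phi> \<and>
           \<rho> = \<phi> (1 mod int m) \<and>
           cyclic_sieving (SYT la mu) m \<rho> (fake_degree la mu)"
proof -
  let ?x = "row_position mu" and ?y = "row_position la" and ?X = "SYT la mu"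
  note m = assms(1) and skew = assms(2)
  have mula: "mu i \<le> la i" for i using skew by (simp add: skew_shape_def)
  have "row_boxes la mu i = Pair i ` {mu i..<la i}" for i
    by (auto simp: row_boxes_def skew_diagram_def)
  then have "card (row_boxes la mu i) = la i - mu i" for i
    by (simp add: card_image inj_on_def)
  then have rows: "m dvd la i - mu i" for i using assms(3)[of i] by simp
  have "finite {i. la i \<noteq> 0}" using skew by (simp add: skew_shape_def int_partition_def)
  then obtain r where "{i. la i \<noteq> 0} \<subseteq> {..<r}" using finite_nat_iff_bounded by blast
  then have r: "la i = 0" if "r \<le> i" for i using that by (auto simp: subset_eq)
  have x: "separated r (\<lambda>_. 0) ?x" and y: "separated r (\<lambda>_. 0) ?y"
    using skew by (auto simp: skew_shape_def intro: row_position_separated)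
  have le: "?x l \<le> ?y l" for l using mula[of l] by (simp add: row_position_def)
  have dvd: "int m dvd ?y l - ?x l" for l
  proof -
    have "int m dvd int (la l - mu l)" using rows by simp
    then show ?thesis using mula[of l] by (simp add: row_position_def)
  qed
  obtain N :: "nat \<Rightarrow> nat" where
    N: "\<And>d. d dvd m \<Longrightarrow> of_nat (\<Sum>e | e dvd d. e * N e) = root_value r ?x ?y (m div d)"
    using root_value_orbit_counts[OF x y le dvd m] by blast
  have root: "poly (map_poly of_nat (fake_degree la mu)) z = root_value r ?x ?y j"
    if "j dvd m" "primitive_root_of_unity j z" for j z
    using skew r rows that by (rule fake_degree_at_root)
  have fin: "finite ?X"
    using bij_betw_finite[OF bij_betw_tableau_word[OF skew r]] finite_walks by blast
  \<comment> \<open>The number of tableaux is the value at 1, the primitive root of order 1.\<close>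
  have "primitive_root_of_unity 1 1" by (auto simp: primitive_root_of_unity_def)
  from root[OF one_dvd this] have "of_nat (card ?X) = root_value r ?x ?y 1"
    by (simp add: poly_fake_degree)
  also have "\<dots> = of_nat (\<Sum>e | e dvd m. e * N e)" using N[of m] m by simp
  finally have "card ?X = (\<Sum>e | e dvd m. e * N e)" by (simp only: of_nat_eq_iff)
  from cycles_power_fixpoints[OF fin this m]
  obtain \<rho> where \<rho>: "\<rho> \<in> carrier (BijGroup ?X)"
      "\<rho> [^]\<^bsub>BijGroup ?X\<^esub> m = \<one>\<^bsub>BijGroup ?X\<^esub>"
    and fixpoints: "\<And>t::nat. card {T \<in> ?X. (\<rho> [^]\<^bsub>BijGroup ?X\<^esub> t) T = T} =
      (\<Sum>e | e dvd m \<and> e dvd t. e * N e)"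
    by blast
  let ?\<phi> = "\<lambda>k::int. \<rho> [^]\<^bsub>BijGroup ?X\<^esub> k"
  note action = group_action_of_power_eq_one[OF \<rho> m]
  have "of_nat (card {T \<in> ?X. ?\<phi> d T = T}) =
      poly (map_poly of_nat (fake_degree la mu)) (\<zeta> powi d)"
    if \<zeta>: "primitive_root_of_unity m \<zeta>" for \<zeta> and d :: int
  proof -
    define t where "t = nat (d mod int m)"
    have t: "int t = d mod int m" using m by (simp add: t_def)
    have "?\<phi> d = \<rho> [^]\<^bsub>BijGroup ?X\<^esub> t"
      using action(2)[of d] by (simp add: int_pow_int flip: t)
    then have "card {T \<in> ?X. ?\<phi> d T = T} = (\<Sum>e | e dvd gcd t m. e * N e)"
      by (simp add: fixpoints conj_commute)
    moreover have "\<zeta> powi d = \<zeta> ^ t"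
    proof -
      have "\<zeta> powi d = \<zeta> powi (int m * (d div int m) + int t)" by (simp add: t)
      also have "\<dots> = (\<zeta> powi int m) powi (d div int m) * \<zeta> powi int t"
        using primitive_root_nonzero[OF \<zeta>] by (simp only: power_int_add power_int_mult simp_thms)
      finally show ?thesis using \<zeta> by (simp add: primitive_root_of_unity_def)
    qed
    moreover have "m div gcd t m dvd m" by (metis dvd_div_mult_self dvd_triv_left gcd_dvd2)
    ultimately show ?thesis
      using N[of "gcd t m"] root[OF _ primitive_root_power[OF \<zeta>, of t]] by simp
  qed
  then have "cyclic_sieving ?X m \<rho> (fake_degree la mu)"
    using fin m \<rho> by (simp add: cyclic_sieving_def)
  moreover have "\<rho> = ?\<phi> (1 mod int m)"
    unfolding action(2) using group.int_pow_1[OF group_BijGroup \<rho>(1)] by simp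
  ultimately show ?thesis using action(1) by blast
qed

end
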